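(* Let $m\in\mathbb N$. For every Dirichlet series $\sum_n a_n n^{-s}\in\mathcal H^m_\infty$, the non-increasing rearrangement $(a_n^* )$ of $(|a_n|)$ belongs to $\ell_{\frac{2m}{m+1},1}$ (equivalently, $(a_n)\in\ell_{\frac{2m}{m+1},1}$).
   Context: A Dirichlet series $\sum_n a_n n^{-s}$ is $m$-homogeneous if $a_n\ne0$ implies $n=\mathfrak p^\alpha=\prod_k p_k^{\alpha_k}$ with $|\alpha|=\sum_k\alpha_k=m$ ($p_k$ the $k$-th prime). $\mathcal H^m_\infty$ is the space of $m$-homogeneous Dirichlet series converging on $\{\mathrm{Re}\,s>0\}$ whose sum is a bounded function there. For $1<p<\infty$, $\ell_{p,1}$ is the space of sequences $x$ with $\sum_k x_k^*(k^{1/p}-(k-1)^{1/p})<\infty$, $x^*$ the non-increasing rearrangement of $(|x_k|)$. *)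

theory Defs
  imports "HOL-Analysis.Analysis" "HOL-Computational_Algebra.Primes"
begin

text \<open>Coefficients of a Dirichlet series: a :: nat => complex, a n is the coefficient of n^(-s);
  the value a 0 plays no role (it is forced to vanish by homogeneity below).\<close>

definition m_homogeneous :: "nat \<Rightarrow> (nat \<Rightarrow> complex) \<Rightarrow> bool" where
  "m_homogeneous m a \<longleftrightarrow> (\<forall>n. a n \<noteq> 0 \<longrightarrow> n > 0 \<and> size (prime_factorization n) = m)"

definition dirichlet_sum :: "(nat \<Rightarrow> complex) \<Rightarrow> complex \<Rightarrow> complex" where
  "dirichlet_sum a s = (\<Sum>n. a n / of_nat n powr s)"

definition H_m_infty :: "nat \<Rightarrow> (nat \<Rightarrow> complex) set" where
  "H_m_infty m = {a. m_homogeneous m a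
      \<and> (\<forall>s. Re s > 0 \<longrightarrow> summable (\<lambda>n. a n / of_nat n powr s))
      \<and> (\<exists>B. \<forall>s. Re s > 0 \<longrightarrow> norm (dirichlet_sum a s) \<le> B)}"

text \<open>Non-increasing rearrangement (1-indexed, k >= 1) of (|x_n|):
  x*_k = inf { t >= 0 : #{n : |x_n| > t} < k }.\<close>
definition decr_rearr :: "(nat \<Rightarrow> 'a::real_normed_vector) \<Rightarrow> nat \<Rightarrow> real" where
  "decr_rearr x k = Inf {t::real. t \<ge> 0 \<and> finite {n. norm (x n) > t} \<and> card {n. norm (x n) > t} < k}"

text \<open>Lorentz sequence space l_{p,1}: sum_{k>=1} x*_k (k^(1/p) - (k-1)^(1/p)) < infinity.
  (Boundedness of x, i.e. finiteness of x*_1, is part of membership.)\<close>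
definition lorentz_p1 :: "real \<Rightarrow> (nat \<Rightarrow> 'a::real_normed_vector) set" where
  "lorentz_p1 p = {x. bounded (range x) \<and>
      summable (\<lambda>k. decr_rearr x (Suc k) * (real (Suc k) powr (1/p) - real k powr (1/p)))}"

end

theory Submission
  imports
    Defs
    "HOL-Probability.Characteristic_Functions"
    "HOL-Complex_Analysis.Conformal_Mappings"
    "HOL-Number_Theory.Residue_Primitive_Roots"
begin

text \<open>
  Replacing the sum \<open>D(s)\<close> of the series by its Gaussian averages along vertical lines multiplies \<open>a\<^sub>n\<close> by
  rapidly decaying weights tending to \<open>1\<close>, and keeps the bound \<open>B\<close>. The averaged series converges
  absolutely up to the imaginary axis, so Kronecker's theorem and the maximum principle bound by
  \<open>B\<close>, on the whole polydisc, every polynomial \<open>P(z) = \<Sum> a\<^sub>n z\<^sup>\<alpha>\<close> (where \<open>n = p\<^sup>\<alpha>\<close>) built from finitely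
  many primes.

  Put \<open>h(p) = (\<Sum> |a\<^sub>n|\<^sup>2)\<^sup>1\<^sup>/\<^sup>2\<close>, the sum being over the \<open>n\<close> divisible by \<open>p\<close>. Cauchy's estimate gives
  \<open>\<Sum>\<^sub>p |z\<^sub>p \<partial>P/\<partial>z\<^sub>p| \<le> 2\<^sup>m B\<close> on the torus, and for \<open>m\<close>-homogeneous polynomials the \<open>L\<^sup>2\<close> norm is at most
  a constant times the \<open>L\<^sup>1\<close> norm, because an integer with \<open>2m\<close> prime factors has at most \<open>4\<^sup>m\<close>
  divisors. Hence \<open>\<Sum>\<^sub>p h(p) \<le> C B\<close>.

  Finally let \<open>H(n)\<close> be the minimum of \<open>h(p)\<close> over the primes \<open>p\<close> dividing \<open>n\<close>. Then
  \<open>\<Sum> |a\<^sub>n|\<^sup>2 / H(n) \<le> \<Sum>\<^sub>p h(p)\<close>, while \<open>#{n. H(n) > t} \<le> (#{p. h(p) > t})\<^sup>m\<close> yields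
  \<open>\<Sum>\<^sub>k H(n\<^sub>k) k\<^sup>1\<^sup>/\<^sup>m\<^sup>-\<^sup>1 \<le> m \<Sum>\<^sub>p h(p)\<close> for every enumeration of distinct \<open>n\<^sub>k\<close>. The inequality
  \<open>2 |a| b \<le> |a|\<^sup>2 / H + H b\<^sup>2\<close> with \<open>b\<^sup>2 = k\<^sup>1\<^sup>/\<^sup>m\<^sup>-\<^sup>1\<close> combines the two into the Lorentz bound.
\<close>

section \<open>Averages of homogeneous polynomials over the torus\<close>

text \<open>The monomial \<open>z\<^sup>\<alpha>\<close> for \<open>n = p\<^sup>\<alpha>\<close>, with variables indexed by the primes themselves;
  the junk value at \<open>n = 0\<close> is \<open>1\<close>.\<close>

definition cmon :: "(nat \<Rightarrow> complex) \<Rightarrow> nat \<Rightarrow> complex" where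
  "cmon z n = prod_mset (image_mset z (prime_factorization n))"

lemma cmon_mult: "a > 0 \<Longrightarrow> b > 0 \<Longrightarrow> cmon z (a * b) = cmon z a * cmon z b"
  by (simp add: cmon_def prime_factorization_mult)

text \<open>A finite substitute for integration over the torus: \<open>\<theta>\<^sub>j(p) = exp (2 \<pi> i j ind(p) / M)\<close>, where
  \<open>M = q - 1\<close> and \<open>ind\<close> is the discrete logarithm modulo a prime \<open>q\<close> exceeding all elements of \<open>S\<close>.\<close>
lemma steinhaus_average:
  fixes S :: "nat set"
  assumes fin: "finite S" and pos: "\<And>n. n \<in> S \<Longrightarrow> n > 0"
  obtains M :: nat and \<theta> :: "nat \<Rightarrow> nat \<Rightarrow> complex"
  where "M > 0" "\<And>j p. norm (\<theta> j p) = 1"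
    "\<And>a b. a \<in> S \<Longrightarrow> b \<in> S \<Longrightarrow>
       (\<Sum>j<M. cmon (\<theta> j) a * cnj (cmon (\<theta> j) b)) = (if a = b then of_nat M else 0)"
proof -
  \<comment> \<open>As \<open>q\<close> exceeds every element of \<open>S\<close>, each
    \<open>n\<close> in \<open>S\<close> is a unit modulo \<open>q\<close> and is determined by its
    residue. \<open>insert 1\<close> keeps \<open>Max\<close> meaningful for empty
    \<open>S\<close>.\<close>
  obtain q where q: "prime q" and qS: "q > Max (insert 1 S)"
    using bigger_prime by blast
  have ltq: "n < q" if "n \<in> S" for n
    using qS that fin by (meson Max_ge finite_insert insertI2 le_less_trans)
  obtain g where g: "residue_primroot q g"
    using q prime_primitive_root_exists[of q] prime_gt_1_nat by auto
  define M where "M = ord q g"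
  have cop: "coprime q g" and q1: "q > 1" and Mt: "M = totient q"
    using g q prime_gt_1_nat by (auto simp: residue_primroot_def M_def)
  have M0: "M > 0" using Mt q1 by simp
  have ex: "\<exists>i. [g ^ i = p] (mod q)" if "coprime p q" for p
  proof -
    have "p mod q \<in> totatives q"
      using that q1 by (auto simp: totatives_def coprime_commute intro!: Nat.gr0I)
    then obtain i where "p mod q = g ^ i mod q"
      using residue_primroot_is_generator[OF q1 g] by (auto simp: bij_betw_def)
    then show ?thesis by (auto simp: cong_def)
  qed
  define ind where "ind p = (SOME i. [g ^ i = p] (mod q))" for p
  have ind: "[g ^ ind p = p] (mod q)" if "coprime p q" for p
    unfolding ind_def using someI_ex[OF ex[OF that]] .
  define \<phi> where "\<phi> n = sum_mset (image_mset ind (prime_factorization n))" for n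
  have \<phi>: "[g ^ \<phi> n = n] (mod q)" if "n \<in> S" for n
  proof -
    have "coprime n q"
      using that ltq[OF that] pos[OF that] q
      by (metis coprime_commute nat_dvd_not_less prime_imp_coprime)
    then have c: "\<forall>p\<in>#prime_factorization n. coprime p q"
      by (meson coprime_divisors dvd_refl in_prime_factors_imp_dvd)
    have "[g ^ sum_mset (image_mset ind A) = prod_mset A] (mod q)" if "\<forall>p\<in>#A. coprime p q" for A
      using that by (induction A) (auto simp: power_add intro!: cong_mult ind)
    from this[OF c] show ?thesis
      using pos[OF that] by (simp add: \<phi>_def prod_mset_prime_factorization_nat)
  qed
  \<comment> \<open>\<open>M\<close> is the order of \<open>g\<close>, so exponents congruent modulo
    \<open>M\<close> give equal residues modulo \<open>q\<close>, hence equal integers.\<close>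
  have \<phi>_inj: "a = b" if "a \<in> S" "b \<in> S" "[\<phi> a = \<phi> b] (mod M)" for a b
  proof -
    have "[g ^ \<phi> a = g ^ \<phi> b] (mod q)"
      using order_divides_expdiff[OF cop] that(3) by (simp add: M_def)
    then have "[a = b] (mod q)"
      using \<phi> that by (meson cong_sym cong_trans)
    then show ?thesis using ltq that by (simp add: cong_def)
  qed
  define e where "e k = exp (2 * of_real pi * \<i> * of_nat k / of_nat M)" for k :: nat
  define \<theta> where "\<theta> j p = e (ind p) ^ j" for j p
  have e_add: "e (k + l) = e k * e l" for k l
    by (simp add: e_def exp_add [symmetric] algebra_simps add_divide_distrib)
  have norm_e: "norm (e k) = 1" for k
    by (simp add: e_def)
  have e_M: "e k ^ M = 1" for k
  proof -
    have "e k ^ M = exp (of_nat M * (2 * of_real pi * \<i> * of_nat k / of_nat M))"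
      by (simp only: e_def exp_of_nat_mult)
    also have "\<dots> = exp (2 * of_real pi * \<i>) ^ k"
      using M0 by (simp add: exp_of_nat_mult [symmetric] mult_ac)
    also have "\<dots> = 1"
      by (metis exp_two_pi_i power_one)
    finally show ?thesis .
  qed
  have cmon_\<theta>: "cmon (\<theta> j) n = e (\<phi> n) ^ j" for j n
  proof -
    have "prod_mset (image_mset (\<theta> j) A) = e (sum_mset (image_mset ind A)) ^ j" for A
      by (induction A) (auto simp: \<theta>_def e_add power_mult_distrib, simp add: e_def)
    then show ?thesis by (simp add: cmon_def \<phi>_def)
  qed
  show ?thesis
  proof (rule that)
    show "M > 0" by fact
    show "norm (\<theta> j p) = 1" for j p
      by (simp add: \<theta>_def norm_power norm_e)
    fix a b assume ab: "a \<in> S" "b \<in> S"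
    \<comment> \<open>The sum over \<open>j\<close> becomes geometric in \<open>\<zeta>\<close>, an
      \<open>M\<close>-th root of unity that equals 1 only if \<open>a = b\<close>.\<close>
    define \<zeta> where "\<zeta> = e (\<phi> a) * cnj (e (\<phi> b))"
    have *: "(\<Sum>j<M. cmon (\<theta> j) a * cnj (cmon (\<theta> j) b)) = (\<Sum>j<M. \<zeta> ^ j)"
      by (simp add: cmon_\<theta> \<zeta>_def power_mult_distrib)
    have unit: "e k * cnj (e k) = 1" for k
      using norm_e[of k] by (simp add: complex_norm_square [symmetric])
    show "(\<Sum>j<M. cmon (\<theta> j) a * cnj (cmon (\<theta> j) b)) = (if a = b then of_nat M else 0)"
    proof (cases "a = b")
      case True
      then have "\<zeta> = 1" by (simp add: \<zeta>_def unit)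
      with True show ?thesis unfolding * by simp
    next
      case False
      have "\<zeta> \<noteq> 1"
      proof
        assume "\<zeta> = 1"
        then have "e (\<phi> a) = e (\<phi> b)"
          using unit[of "\<phi> b"] unfolding \<zeta>_def
          by (metis mult.commute mult.left_commute mult.right_neutral)
        then have "[\<phi> a = \<phi> b] (mod M)"
          using complex_root_unity_eq[of M "\<phi> a" "\<phi> b"] M0 by (simp add: e_def cong_def)
        with \<phi>_inj ab False show False by blast
      qed
      moreover have "\<zeta> ^ M = 1"
        by (simp add: \<zeta>_def power_mult_distrib e_M flip: complex_cnj_power)
      ultimately show ?thesis
        using False by (simp add: * sum_gp_strict)
    qed
  qed
qed

text \<open>Orthogonality is asked only on \<open>T\<close>, so that the same sample points serve a
  polynomial and its square.\<close>

lemma parseval_average: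
  fixes c :: "nat \<Rightarrow> complex"
  assumes fin: "finite T"
    and orth: "\<And>a b. a \<in> T \<Longrightarrow> b \<in> T \<Longrightarrow>
       (\<Sum>j<M. cmon (\<theta> j) a * cnj (cmon (\<theta> j) b)) = (if a = b then of_nat M else 0)"
  shows "(\<Sum>j<M. (norm (\<Sum>n\<in>T. c n * cmon (\<theta> j) n))\<^sup>2) = real M * (\<Sum>n\<in>T. (norm (c n))\<^sup>2)"
proof -
  have "of_real (\<Sum>j<M. (norm (\<Sum>n\<in>T. c n * cmon (\<theta> j) n))\<^sup>2)
      = (\<Sum>j<M. (\<Sum>a\<in>T. c a * cmon (\<theta> j) a) * cnj (\<Sum>b\<in>T. c b * cmon (\<theta> j) b))"
    by (simp only: complex_norm_square of_real_sum)
  also have "\<dots> = (\<Sum>j<M. \<Sum>a\<in>T. \<Sum>b\<in>T. c a * cnj (c b) * (cmon (\<theta> j) a * cnj (cmon (\<theta> j) b)))"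
    by (simp add: sum_product mult_ac)
  also have "\<dots> = (\<Sum>a\<in>T. \<Sum>j<M. \<Sum>b\<in>T. c a * cnj (c b) * (cmon (\<theta> j) a * cnj (cmon (\<theta> j) b)))"
    by (rule sum.swap)
  also have "\<dots> = (\<Sum>a\<in>T. \<Sum>b\<in>T. \<Sum>j<M. c a * cnj (c b) * (cmon (\<theta> j) a * cnj (cmon (\<theta> j) b)))"
    by (intro sum.cong refl sum.swap)
  also have "\<dots> = (\<Sum>a\<in>T. \<Sum>b\<in>T. c a * cnj (c b) * (if a = b then of_nat M else 0))"
    by (intro sum.cong refl) (simp only: sum_distrib_left [symmetric] orth)
  also have "\<dots> = (\<Sum>a\<in>T. c a * cnj (c a) * of_nat M)"
    using fin by (intro sum.cong refl) (simp add: if_distrib sum.delta cong: if_cong)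
  also have "\<dots> = of_real (real M * (\<Sum>n\<in>T. (norm (c n))\<^sup>2))"
    by (simp add: complex_norm_square [symmetric] sum_distrib_left mult_ac)
  finally show ?thesis
    using of_real_eq_iff by blast
qed

text \<open>One more prime factor \<open>p\<close> at most doubles the number of divisors: a divisor
  of \<open>p * n\<close> divides \<open>n\<close> or is \<open>p\<close> times a divisor of
  \<open>n\<close>.\<close>

lemma card_divisors_le:
  fixes n :: nat
  assumes "n > 0"
  shows "card {d. d dvd n} \<le> 2 ^ size (prime_factorization n)"
  using assms
proof (induction n rule: prime_divisors_induct)
  case (unit n)
  then show ?case by simp
next
  case (factor p n)
  then have n: "n > 0" and p: "prime p" by auto
  have "{d. d dvd p * n} \<subseteq> {d. d dvd n} \<union> (*) p ` {d. d dvd n}"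
  proof
    fix d assume "d \<in> {d. d dvd p * n}"
    then have d: "d dvd p * n" by simp
    show "d \<in> {d. d dvd n} \<union> (*) p ` {d. d dvd n}"
    proof (cases "p dvd d")
      case True
      then obtain e where "d = p * e" by auto
      then show ?thesis using d p by auto
    next
      case False
      then have "coprime d p" using p prime_imp_coprime coprime_commute by blast
      then show ?thesis using d coprime_dvd_mult_right_iff by blast
    qed
  qed
  then have "card {d. d dvd p * n} \<le> card ({d. d dvd n} \<union> (*) p ` {d. d dvd n})"
    using n by (intro card_mono) auto
  also have "\<dots> \<le> card {d. d dvd n} + card {d. d dvd n}"
    using n by (intro order_trans[OF card_Un_le] add_mono card_image_le) auto
  also have "\<dots> \<le> 2 ^ size (prime_factorization (p * n))"
    using factor.IH n p by (simp add: prime_factorization_mult prime_factorization_prime)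
  finally show ?case .
qed auto

text \<open>Each coefficient of the squared polynomial is a sum over at most \<open>4 ^ m\<close>
  factorizations, so Parseval for the square controls the fourth moment by the second. Interpolation
  then compares the second moment with the first. The square is why \<open>orth\<close> includes
  products.\<close>

lemma homogeneous_L2_le_L1:
  fixes c :: "nat \<Rightarrow> complex"
  assumes fin: "finite L" and L: "\<And>n. n \<in> L \<Longrightarrow> n > 0 \<and> size (prime_factorization n) = m"
    and M: "M > 0"
    and orth: "\<And>a b. a \<in> L \<union> (\<lambda>(x,y). x * y) ` (L \<times> L) \<Longrightarrow> b \<in> L \<union> (\<lambda>(x,y). x * y) ` (L \<times> L) \<Longrightarrow>
       (\<Sum>j<M. cmon (\<theta> j) a * cnj (cmon (\<theta> j) b)) = (if a = b then of_nat M else 0)"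
  shows "sqrt (\<Sum>n\<in>L. (norm (c n))\<^sup>2)
      \<le> 4 * 2 ^ m * (\<Sum>j<M. norm (\<Sum>n\<in>L. c n * cmon (\<theta> j) n)) / real M"
proof -
  define f where "f j = (\<Sum>n\<in>L. c n * cmon (\<theta> j) n)" for j
  define s where "s = (\<Sum>n\<in>L. (norm (c n))\<^sup>2)"
  define A where "A = (\<Sum>j<M. norm (f j)) / real M"
  define LL where "LL = (\<lambda>(x,y). x * y) ` (L \<times> L)"
  define P where "P N = {xy \<in> L \<times> L. fst xy * snd xy = N}" for N
  define d where "d N = (\<Sum>(x,y)\<in>P N. c x * c y)" for N
  have fin': "finite LL" "finite (P N)" for N
    using fin by (auto simp: LL_def P_def)
  have s0: "s \<ge> 0" by (simp add: s_def sum_nonneg)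
  have A0: "A \<ge> 0" by (simp add: A_def sum_nonneg)
  have two: "(\<Sum>j<M. (norm (f j))\<^sup>2) = real M * s"
    unfolding f_def s_def by (rule parseval_average[OF fin]) (use orth in auto)
  have group: "(\<Sum>N\<in>LL. \<Sum>xy\<in>P N. g xy) = (\<Sum>xy\<in>L\<times>L. g xy)" for g :: "nat \<times> nat \<Rightarrow> 'a :: comm_monoid_add"
  proof -
    have "(\<lambda>xy. fst xy * snd xy) ` (L \<times> L) \<subseteq> LL" by (force simp: LL_def)
    from sum.group[OF finite_cartesian_product[OF fin fin] fin'(1) this, of g]
    show ?thesis by (simp add: P_def)
  qed
  have sq: "(f j)\<^sup>2 = (\<Sum>N\<in>LL. d N * cmon (\<theta> j) N)" for j
  proof -
    have "(f j)\<^sup>2 = (\<Sum>xy\<in>L\<times>L. c (fst xy) * cmon (\<theta> j) (fst xy) * (c (snd xy) * cmon (\<theta> j) (snd xy)))"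
      by (simp add: f_def power2_eq_square sum_product sum.cartesian_product case_prod_unfold)
    also have "\<dots> = (\<Sum>N\<in>LL. \<Sum>xy\<in>P N. c (fst xy) * cmon (\<theta> j) (fst xy) * (c (snd xy) * cmon (\<theta> j) (snd xy)))"
      by (rule group [symmetric])
    also have "\<dots> = (\<Sum>N\<in>LL. d N * cmon (\<theta> j) N)"
      unfolding d_def sum_distrib_right
      by (intro sum.cong refl) (use L cmon_mult in \<open>auto simp: P_def mult_ac\<close>)
    finally show ?thesis .
  qed
  have dle: "(norm (d N))\<^sup>2 \<le> 4 ^ m * (\<Sum>xy\<in>P N. (norm (c (fst xy)))\<^sup>2 * (norm (c (snd xy)))\<^sup>2)" if "N \<in> LL" for N
  proof -
    obtain x y where xy: "x \<in> L" "y \<in> L" "N = x * y" using \<open>N \<in> LL\<close> by (auto simp: LL_def)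
    have N: "N > 0" "size (prime_factorization N) = 2 * m"
      using L xy by (auto simp: prime_factorization_mult)
    \<comment> \<open>Since elements of \<open>L\<close> are positive, the first factor of
      \<open>N\<close> determines the second; factorizations are thus counted by divisors of
      \<open>N\<close>.\<close>
    have "inj_on fst (P N)"
      using L by (fastforce simp: P_def inj_on_def)
    then have "card (P N) = card (fst ` P N)" by (simp add: card_image)
    also have "\<dots> \<le> card {k. k dvd N}"
      using N by (intro card_mono) (auto simp: P_def)
    also have "\<dots> \<le> 4 ^ m" using card_divisors_le[OF N(1)] N(2) by (simp add: power_mult)
    finally have cP: "real (card (P N)) \<le> 4 ^ m"
      by (metis of_nat_le_iff of_nat_numeral of_nat_power)
    have "norm (d N) \<le> (\<Sum>xy\<in>P N. norm (c (fst xy)) * norm (c (snd xy)))"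
      unfolding d_def by (rule order_trans[OF norm_sum]) (simp add: norm_mult case_prod_unfold)
    then have "(norm (d N))\<^sup>2 \<le> (\<Sum>xy\<in>P N. norm (c (fst xy)) * norm (c (snd xy)))\<^sup>2"
      by (simp add: power_mono)
    also have "\<dots> \<le> (\<Sum>xy\<in>P N. 1\<^sup>2) * (\<Sum>xy\<in>P N. (norm (c (fst xy)) * norm (c (snd xy)))\<^sup>2)"
      using Cauchy_Schwarz_ineq_sum[of "\<lambda>_. 1" "\<lambda>xy. norm (c (fst xy)) * norm (c (snd xy))" "P N"] by simp
    also have "\<dots> \<le> 4 ^ m * (\<Sum>xy\<in>P N. (norm (c (fst xy)))\<^sup>2 * (norm (c (snd xy)))\<^sup>2)"
      using cP by (auto simp: power_mult_distrib intro!: mult_right_mono sum_nonneg)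
    finally show ?thesis .
  qed
  have "(\<Sum>j<M. (norm (f j)) ^ 4) = (\<Sum>j<M. (norm (\<Sum>N\<in>LL. d N * cmon (\<theta> j) N))\<^sup>2)"
    by (simp add: sq [symmetric] norm_power flip: power_mult)
  also have "\<dots> = real M * (\<Sum>N\<in>LL. (norm (d N))\<^sup>2)"
    by (rule parseval_average[OF fin'(1)]) (use orth in \<open>auto simp: LL_def\<close>)
  also have "\<dots> \<le> real M * (\<Sum>N\<in>LL. 4 ^ m * (\<Sum>xy\<in>P N. (norm (c (fst xy)))\<^sup>2 * (norm (c (snd xy)))\<^sup>2))"
    by (intro mult_left_mono sum_mono dle) auto
  also have "\<dots> = real M * 4 ^ m * (\<Sum>xy\<in>L\<times>L. (norm (c (fst xy)))\<^sup>2 * (norm (c (snd xy)))\<^sup>2)"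
    by (simp add: group flip: sum_distrib_left)
  also have "\<dots> = real M * 4 ^ m * s\<^sup>2"
    by (simp add: s_def power2_eq_square sum_product sum.cartesian_product case_prod_unfold)
  finally have four: "(\<Sum>j<M. (norm (f j)) ^ 4) \<le> real M * 4 ^ m * s\<^sup>2" .
  have "sqrt s \<le> 4 * 2 ^ m * A"
  proof (cases "s = 0")
    case True
    then show ?thesis using A0 by simp
  next
    case False
    with s0 have s: "s > 0" by simp
    \<comment> \<open>Chosen so that the fourth-moment term
      \<open>4 ^ m * s\<^sup>2 / \<kappa>\<^sup>2\<close> is exactly \<open>s / 4\<close>, which the
      left side absorbs. The resulting constant 8/3 is rounded up to 4.\<close>
    define \<kappa> where "\<kappa> = 2 * 2 ^ m * sqrt s"
    have \<kappa>: "\<kappa> > 0" using s by (simp add: \<kappa>_def)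
    have \<kappa>2: "\<kappa>\<^sup>2 = 4 * 4 ^ m * s"
    proof -
      have "(4::real) ^ m = 2 ^ m * 2 ^ m" by (simp flip: power_mult_distrib)
      then show ?thesis
        using s by (simp add: \<kappa>_def power_mult_distrib power2_eq_square)
    qed
    \<comment> \<open>This interpolation of \<open>L\<^sup>2\<close> between \<open>L\<^sup>1\<close> and \<open>L\<^sup>4\<close> replaces Hoelder's inequality.\<close>
    have pt: "y\<^sup>2 \<le> \<kappa> * y + y ^ 4 / \<kappa>\<^sup>2" if "y \<ge> 0" for y
    proof -
      define u where "u = y / \<kappa>"
      have u: "u \<ge> 0" "y = \<kappa> * u" using \<kappa> that by (auto simp: u_def)
      have "u\<^sup>2 \<le> u + u ^ 4"
      proof (cases "u \<le> 1")
        case True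
        then have "u\<^sup>2 \<le> u" using u by (simp add: power2_eq_square mult_left_le)
        moreover have "0 \<le> u ^ 4" using u by simp
        ultimately show ?thesis by linarith
      next
        case False
        then have "u\<^sup>2 \<le> u ^ 4" by (intro power_increasing) auto
        then show ?thesis using u by linarith
      qed
      then have "\<kappa>\<^sup>2 * u\<^sup>2 \<le> \<kappa>\<^sup>2 * (u + u ^ 4)" by (intro mult_left_mono) auto
      also have "\<dots> = \<kappa> * y + y ^ 4 / \<kappa>\<^sup>2"
        using \<kappa> by (simp add: u(2) field_simps power2_eq_square power4_eq_xxxx)
      finally show ?thesis by (simp add: u(2) power_mult_distrib)
    qed
    have "real M * s \<le> (\<Sum>j<M. \<kappa> * norm (f j) + norm (f j) ^ 4 / \<kappa>\<^sup>2)"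
      unfolding two [symmetric] by (intro sum_mono pt) auto
    also have "\<dots> = \<kappa> * (real M * A) + (\<Sum>j<M. norm (f j) ^ 4) / \<kappa>\<^sup>2"
      using M by (simp add: sum.distrib A_def sum_distrib_left sum_divide_distrib)
    also have "\<dots> \<le> \<kappa> * (real M * A) + real M * 4 ^ m * s\<^sup>2 / \<kappa>\<^sup>2"
      by (intro add_left_mono divide_right_mono four) auto
    also have "\<dots> = real M * (\<kappa> * A + s / 4)"
      unfolding \<kappa>2 using s by (simp add: field_simps power2_eq_square)
    finally have "s \<le> \<kappa> * A + s / 4" using M by simp
    then have "3 * s \<le> 4 * (\<kappa> * A)" by linarith
    moreover have "sqrt s * (3 * sqrt s) = 3 * s" using s by simp
    moreover have "4 * (\<kappa> * A) = sqrt s * (8 * 2 ^ m * A)" by (simp add: \<kappa>_def)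
    ultimately have "sqrt s * (3 * sqrt s) \<le> sqrt s * (8 * 2 ^ m * A)" by linarith
    then have "3 * sqrt s \<le> 8 * 2 ^ m * A"
      by (rule mult_left_le_imp_le) (use s in simp)
    moreover have "0 \<le> 2 ^ m * A" using A0 by simp
    ultimately show ?thesis by linarith
  qed
  then show ?thesis by (simp add: s_def A_def f_def)
qed

section \<open>Polynomials bounded on the polydisc\<close>

lemma cmon_cong: "(\<And>p. p \<in> prime_factors n \<Longrightarrow> z p = y p) \<Longrightarrow> cmon z n = cmon y n"
  unfolding cmon_def by (metis image_mset_cong)

lemma cmon_scale: "cmon (\<lambda>p. c * y p) n = c ^ size (prime_factorization n) * cmon y n"
proof -
  have "prod_mset (image_mset (\<lambda>p. c * y p) A) = c ^ size A * prod_mset (image_mset y A)" for A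
    by (induction A) (auto simp: mult_ac)
  then show ?thesis by (simp add: cmon_def)
qed

lemma holomorphic_cmon_update: "(\<lambda>x. cmon (z(p := x)) n) holomorphic_on S"
proof -
  have "(\<lambda>x. prod_mset (image_mset (z(p := x)) A)) holomorphic_on S" for A
  proof (induction A)
    case (add q A)
    have "(\<lambda>x. (z(p := x)) q) holomorphic_on S" by (cases "q = p") (auto intro: holomorphic_intros)
    from holomorphic_on_mult[OF this add] show ?case by simp
  qed auto
  then show ?thesis by (simp add: cmon_def)
qed

text \<open>The maximum principle is applied to one variable at a time, by induction on the set
  \<open>U\<close> of variables allowed to leave the unit circle.\<close>

lemma polydisc_bound:
  fixes a :: "nat \<Rightarrow> complex"
  assumes fin: "finite L"
    and torus: "\<And>z. (\<And>p. norm (z p) = 1) \<Longrightarrow> norm (\<Sum>n\<in>L. a n * cmon z n) \<le> B"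
    and z: "\<And>p. norm (z p) \<le> 1"
  shows "norm (\<Sum>n\<in>L. a n * cmon z n) \<le> B"
proof -
  have *: "norm (\<Sum>n\<in>L. a n * cmon z n) \<le> B"
    if "finite U" "\<And>p. p \<in> U \<Longrightarrow> norm (z p) \<le> 1" "\<And>p. p \<notin> U \<Longrightarrow> norm (z p) = 1" for U z
    using that
  proof (induction U arbitrary: z)
    case empty
    then show ?case by (intro torus) auto
  next
    case (insert p U)
    define f where "f x = (\<Sum>n\<in>L. a n * cmon (z(p := x)) n)" for x
    have holo: "f holomorphic_on S" for S
      unfolding f_def by (intro holomorphic_intros holomorphic_cmon_update)
    have "norm (f (z p)) \<le> B"
    proof (rule maximum_modulus_frontier[of f "cball 0 1"])
      show "norm (f w) \<le> B" if "w \<in> frontier (cball 0 1)" for w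
        unfolding f_def using that insert.prems by (intro insert.IH) (auto simp: dist_norm)
      show "z p \<in> cball 0 1" using insert.prems by auto
    qed (use holo in \<open>auto intro: holomorphic_on_imp_continuous_on\<close>)
    then show ?case by (simp add: f_def)
  qed
  \<comment> \<open>Variables not occurring in the polynomial are reset to 1, which leaves only
    finitely many off the circle.\<close>
  define U where "U = (\<Union>n\<in>L. prime_factors n)"
  define y where "y p = (if p \<in> U then z p else 1)" for p
  have "(\<Sum>n\<in>L. a n * cmon z n) = (\<Sum>n\<in>L. a n * cmon y n)"
    by (intro sum.cong refl arg_cong2[of _ _ _ _ "(*)"] cmon_cong) (auto simp: y_def U_def)
  also have "norm \<dots> \<le> B"
    by (rule *[of U]) (use fin z in \<open>auto simp: U_def y_def\<close>)
  finally show ?thesis .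
qed

lemma sum_mset_eq_sum_count:
  fixes v :: "'a \<Rightarrow> complex"
  assumes "finite Q" and "\<And>p. p \<notin> Q \<Longrightarrow> v p = 0"
  shows "sum_mset (image_mset v A) = (\<Sum>p\<in>Q. of_nat (count A p) * v p)"
proof (induction A)
  case (add q A)
  have "(\<Sum>p\<in>Q. of_nat (count (add_mset q A) p) * v p)
      = (\<Sum>p\<in>Q. of_nat (count A p) * v p + (if q = p then v p else 0))"
    by (intro sum.cong refl) (auto simp: algebra_simps)
  also have "\<dots> = (\<Sum>p\<in>Q. of_nat (count A p) * v p) + v q"
    using assms by (simp add: sum.distrib)
  finally show ?case using add by simp
qed auto

text \<open>The operator below is \<open>z\<^sub>p \<partial>/\<partial>z\<^sub>p\<close>; the bound is Cauchy's estimate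
  at \<open>0\<close> for \<open>\<lambda> \<mapsto> P(z\<^sub>p (1 + \<lambda> v\<^sub>p))\<close>, with unimodular \<open>v\<close> aligning the summands.\<close>
lemma sum_euler_derivatives_le:
  fixes a :: "nat \<Rightarrow> complex"
  assumes L: "\<And>n. n \<in> L \<Longrightarrow> size (prime_factorization n) = m"
    and disc: "\<And>z. (\<And>p. norm (z p) \<le> 1) \<Longrightarrow> norm (\<Sum>n\<in>L. a n * cmon z n) \<le> B"
    and z: "\<And>p. norm (z p) = 1" and Q: "finite Q"
  shows "(\<Sum>p\<in>Q. norm (\<Sum>n\<in>L. of_nat (count (prime_factorization n) p) * a n * cmon z n)) \<le> 2 ^ m * B"
proof -
  define E where "E p = (\<Sum>n\<in>L. of_nat (count (prime_factorization n) p) * a n * cmon z n)" for p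
  \<comment> \<open>Vanishing off \<open>Q\<close> turns the sum over prime factors into one over
    \<open>Q\<close>. Where \<open>E p = 0\<close>, \<open>sgn\<close> is 0 as well, so
    \<open>E p * v p = norm (E p)\<close> holds there too.\<close>
  define v where "v p = (if p \<in> Q then cnj (sgn (E p)) else 0)" for p
  have v: "norm (v p) \<le> 1" for p by (simp add: v_def norm_sgn)
  define y where "y x p = z p * (1 + x * v p)" for x p
  define q where "q x = (\<Sum>n\<in>L. a n * cmon (y x) n)" for x
  have prod_deriv: "((\<lambda>x. prod_mset (image_mset (y x) A)) has_field_derivative
      prod_mset (image_mset z A) * sum_mset (image_mset v A)) (at 0)" for A
  proof (induction A)
    case (add p A)
    have "((\<lambda>x. y x p) has_field_derivative z p * v p) (at 0)"
      unfolding y_def by (auto intro!: derivative_eq_intros)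
    from DERIV_mult[OF this add] show ?case
      by (simp add: y_def algebra_simps)
  qed auto
  have holo: "(\<lambda>x. prod_mset (image_mset (y x) A)) holomorphic_on S" for A S
  proof (induction A)
    case (add p A)
    have "(\<lambda>x. y x p) holomorphic_on S" unfolding y_def by (intro holomorphic_intros)
    from holomorphic_on_mult[OF this add] show ?case by simp
  qed auto
  have qholo: "q holomorphic_on S" for S
    unfolding q_def cmon_def by (intro holomorphic_intros holo)
  have "(q has_field_derivative (\<Sum>n\<in>L. a n * (cmon z n * sum_mset (image_mset v (prime_factorization n))))) (at 0)"
    unfolding q_def cmon_def by (intro DERIV_sum DERIV_cmult prod_deriv)
  then have "deriv q 0 = (\<Sum>n\<in>L. a n * (cmon z n * sum_mset (image_mset v (prime_factorization n))))"
    by (rule DERIV_imp_deriv)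
  also have "\<dots> = (\<Sum>n\<in>L. \<Sum>p\<in>Q. of_nat (count (prime_factorization n) p) * a n * cmon z n * v p)"
    by (subst sum_mset_eq_sum_count[OF Q]) (auto simp: v_def sum_distrib_left mult_ac)
  also have "\<dots> = (\<Sum>p\<in>Q. E p * v p)"
    by (subst sum.swap) (simp add: E_def sum_distrib_right)
  also have "\<dots> = (\<Sum>p\<in>Q. of_real (norm (E p)))"
  proof (intro sum.cong refl)
    fix p assume "p \<in> Q"
    have "E p * cnj (E p) = of_real (norm (E p)) * of_real (norm (E p))"
      by (simp flip: complex_norm_square power2_eq_square)
    with \<open>p \<in> Q\<close> show "E p * v p = of_real (norm (E p))"
      by (simp add: v_def sgn_eq)
  qed
  finally have d: "deriv q 0 = of_real (\<Sum>p\<in>Q. norm (E p))" by simp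
  have "norm ((deriv ^^ 1) q 0) \<le> fact 1 * (2 ^ m * B) / 1 ^ 1"
  proof (rule Cauchy_inequality)
    fix x :: complex assume "norm (0 - x) = 1"
    then have x: "norm x = 1" by simp
    \<comment> \<open>The point \<open>y x\<close> lies in the polydisc of radius 2; halving it
      brings it into the unit polydisc, and homogeneity pays for this with
      \<open>2 ^ m\<close>.\<close>
    have yb: "norm (y x p / 2) \<le> 1" for p
    proof -
      have "norm (1 + x * v p) \<le> 1 + norm x * norm (v p)"
        by (metis norm_mult norm_one norm_triangle_ineq)
      then show ?thesis using v[of p] x by (simp add: y_def norm_mult norm_divide z)
    qed
    have "q x = (\<Sum>n\<in>L. a n * cmon (\<lambda>p. 2 * (y x p / 2)) n)"
      by (simp add: q_def)
    also have "\<dots> = (\<Sum>n\<in>L. 2 ^ m * (a n * cmon (\<lambda>p. y x p / 2) n))"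
      unfolding cmon_scale by (intro sum.cong refl) (simp add: L)
    also have "\<dots> = 2 ^ m * (\<Sum>n\<in>L. a n * cmon (\<lambda>p. y x p / 2) n)"
      by (rule sum_distrib_left [symmetric])
    finally show "norm (q x) \<le> 2 ^ m * B"
      using disc[of "\<lambda>p. y x p / 2"] yb by (simp add: norm_mult norm_power)
  qed (use qholo in \<open>auto intro: holomorphic_on_imp_continuous_on\<close>)
  then have "norm (deriv q 0) \<le> 2 ^ m * B" by simp
  moreover have "norm (complex_of_real (\<Sum>p\<in>Q. norm (E p))) = (\<Sum>p\<in>Q. norm (E p))"
    by (simp only: norm_of_real abs_of_nonneg sum_nonneg norm_ge_zero)
  ultimately show ?thesis
    using d by (simp add: E_def)
qed

text \<open>For each \<open>p\<close> the comparison of second and first moments is applied to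
  \<open>z\<^sub>p \<partial>P/\<partial>z\<^sub>p\<close>. With the sum over \<open>p\<close> moved
  inside the average, Cauchy's estimate applies at every sample point; the two factors
  \<open>2 ^ m\<close> make \<open>4 ^ m\<close>.\<close>

lemma mixed_norm_bound:
  fixes a :: "nat \<Rightarrow> complex"
  assumes fin: "finite L" and L: "\<And>n. n \<in> L \<Longrightarrow> n > 0 \<and> size (prime_factorization n) = m"
    and disc: "\<And>z. (\<And>p. norm (z p) \<le> 1) \<Longrightarrow> norm (\<Sum>n\<in>L. a n * cmon z n) \<le> B"
    and Q: "finite Q"
  shows "(\<Sum>p\<in>Q. sqrt (\<Sum>n | n \<in> L \<and> p \<in> prime_factors n. (norm (a n))\<^sup>2)) \<le> 4 * 4 ^ m * B"
proof -
  define S where "S = L \<union> (\<lambda>(x,y). x * y) ` (L \<times> L)"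
  have "finite S" "\<And>n. n \<in> S \<Longrightarrow> n > 0" using fin L by (auto simp: S_def)
  then obtain M \<theta> where M: "M > 0" and \<theta>: "\<And>j p. norm (\<theta> j p) = 1"
    and orth: "\<And>x y. x \<in> S \<Longrightarrow> y \<in> S \<Longrightarrow>
       (\<Sum>j<M. cmon (\<theta> j) x * cnj (cmon (\<theta> j) y)) = (if x = y then of_nat M else 0)"
    using steinhaus_average by blast
  \<comment> \<open>Coefficients of the Euler derivative; they dominate \<open>a n\<close> on
    multiples of \<open>p\<close> because the multiplicity is at least 1 there.\<close>
  define c where "c p n = of_nat (count (prime_factorization n) p) * a n" for p n
  have "sqrt (\<Sum>n | n \<in> L \<and> p \<in> prime_factors n. (norm (a n))\<^sup>2)
      \<le> 4 * 2 ^ m * (\<Sum>j<M. norm (\<Sum>n\<in>L. c p n * cmon (\<theta> j) n)) / real M" for p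
  proof -
    have "(\<Sum>n | n \<in> L \<and> p \<in> prime_factors n. (norm (a n))\<^sup>2) \<le> (\<Sum>n | n \<in> L \<and> p \<in> prime_factors n. (norm (c p n))\<^sup>2)"
    proof (rule sum_mono)
      fix n assume "n \<in> {n. n \<in> L \<and> p \<in> prime_factors n}"
      then have "1 \<le> count (prime_factorization n) p" by (simp add: Suc_leI)
      then have "1 * norm (a n) \<le> real (count (prime_factorization n) p) * norm (a n)"
        by (intro mult_right_mono) (use of_nat_le_iff[where 'a = real] in force)+
      then show "(norm (a n))\<^sup>2 \<le> (norm (c p n))\<^sup>2"
        by (simp add: c_def norm_mult)
    qed
    also have "\<dots> \<le> (\<Sum>n\<in>L. (norm (c p n))\<^sup>2)"
      using fin by (intro sum_mono2) auto
    finally have "sqrt (\<Sum>n | n \<in> L \<and> p \<in> prime_factors n. (norm (a n))\<^sup>2) \<le> sqrt (\<Sum>n\<in>L. (norm (c p n))\<^sup>2)"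
      by simp
    also have "\<dots> \<le> 4 * 2 ^ m * (\<Sum>j<M. norm (\<Sum>n\<in>L. c p n * cmon (\<theta> j) n)) / real M"
      by (rule homogeneous_L2_le_L1[OF fin L M]) (use orth in \<open>auto simp: S_def\<close>)
    finally show ?thesis .
  qed
  then have "(\<Sum>p\<in>Q. sqrt (\<Sum>n | n \<in> L \<and> p \<in> prime_factors n. (norm (a n))\<^sup>2))
      \<le> (\<Sum>p\<in>Q. 4 * 2 ^ m * (\<Sum>j<M. norm (\<Sum>n\<in>L. c p n * cmon (\<theta> j) n)) / real M)"
    by (intro sum_mono)
  also have "\<dots> = 4 * 2 ^ m * (\<Sum>j<M. \<Sum>p\<in>Q. norm (\<Sum>n\<in>L. c p n * cmon (\<theta> j) n)) / real M"
    by (subst sum.swap) (simp flip: sum_distrib_left sum_divide_distrib)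
  also have "\<dots> \<le> 4 * 2 ^ m * (\<Sum>j<M. 2 ^ m * B) / real M"
    unfolding c_def
    by (intro divide_right_mono mult_left_mono sum_mono sum_euler_derivatives_le[OF _ disc \<theta> Q])
      (use L in auto)
  also have "\<dots> = 4 * 4 ^ m * B"
  proof -
    have "(4::real) ^ m = 2 ^ m * 2 ^ m" by (simp flip: power_mult_distrib)
    then show ?thesis using M by simp
  qed
  finally show ?thesis .
qed

section \<open>Lorentz norms\<close>

text \<open>Each such integer is the product of a list of length \<open>m\<close> over
  \<open>S\<close>.\<close>

lemma smooth_numbers_card:
  fixes S :: "nat set" and m :: nat
  assumes S: "finite S"
  defines "N \<equiv> {n. n > 0 \<and> size (prime_factorization n) = m \<and> prime_factors n \<subseteq> S}"
  shows "finite N" "card N \<le> card S ^ m"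
proof -
  let ?X = "{xs. set xs \<subseteq> S \<and> length xs = m}"
  have sub: "N \<subseteq> prod_list ` ?X"
  proof
    fix n assume n: "n \<in> N"
    obtain xs where xs: "mset xs = prime_factorization n" using ex_mset by blast
    have "prod_list xs = n"
      using n xs prod_mset_prime_factorization_nat[of n] by (metis (mono_tags) N_def mem_Collect_eq prod_mset_prod_list)
    moreover have "set xs \<subseteq> S" "length xs = m"
      using n xs by (auto simp: N_def simp flip: set_mset_mset size_mset)
    ultimately show "n \<in> prod_list ` ?X" by blast
  qed
  have X: "finite ?X" using S by (rule finite_lists_length_eq)
  show "finite N" by (rule finite_subset[OF sub finite_imageI[OF X]])
  have "card N \<le> card (prod_list ` ?X)" by (rule card_mono[OF finite_imageI[OF X] sub])
  also have "\<dots> \<le> card ?X" using X by (rule card_image_le)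
  also have "\<dots> = card S ^ m" using S by (rule card_lists_length_eq)
  finally show "card N \<le> card S ^ m" .
qed

text \<open>With \<open>x\<close> and \<open>y\<close> the \<open>m\<close>-th roots of
  \<open>k + 1\<close> and \<open>k\<close>, the identity \<open>x ^ m - y ^ m = 1\<close> factors
  as \<open>x - y\<close> times \<open>m\<close> monomials of degree \<open>m - 1\<close>, each at
  most \<open>x ^ (m - 1)\<close>.\<close>

lemma powr_diff_ge:
  fixes k :: nat
  assumes "m \<ge> 1"
  shows "real (Suc k) powr (1 / real m - 1) \<le> real m * (real (Suc k) powr (1 / real m) - real k powr (1 / real m))"
proof -
  define x where "x = real (Suc k) powr (1 / real m)"
  define y where "y = real k powr (1 / real m)"
  have x: "x > 0" and y: "y \<ge> 0" "y \<le> x"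
    by (auto simp: x_def y_def intro!: powr_mono2)
  have xm: "x ^ m = real (Suc k)"
    unfolding x_def using assms by (simp add: powr_power)
  have ym: "y ^ m = real k"
    unfolding y_def using assms by (cases "k = 0") (auto simp: powr_power)
  have "1 = x ^ m - y ^ m" by (simp add: xm ym)
  also have "\<dots> = (x - y) * (\<Sum>i<m. y ^ (m - Suc i) * x ^ i)"
    by (rule power_diff_sumr2)
  also have "\<dots> \<le> (x - y) * (\<Sum>i<m. x ^ (m - 1))"
  proof (intro mult_left_mono sum_mono)
    fix i assume "i \<in> {..<m}"
    then have "y ^ (m - Suc i) * x ^ i \<le> x ^ (m - Suc i) * x ^ i"
      using x y by (intro mult_right_mono power_mono) auto
    also have "\<dots> = x ^ (m - 1)"
      using \<open>i \<in> {..<m}\<close> by (simp flip: power_add)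
    finally show "y ^ (m - Suc i) * x ^ i \<le> x ^ (m - 1)" .
  qed (use y in auto)
  finally have "1 \<le> real m * (x - y) * x ^ (m - 1)" by (simp add: mult_ac)
  then have "x / x ^ m \<le> x * (real m * (x - y) * x ^ (m - 1)) / x ^ m"
    using x by (intro divide_right_mono) auto
  also have "\<dots> = real m * (x - y)"
  proof -
    have xm': "x * x ^ (m - 1) = x ^ m" using assms by (cases m) auto
    have "x * (real m * (x - y) * x ^ (m - 1)) = real m * (x - y) * x ^ m"
      unfolding xm' [symmetric] by (rule mult.left_commute)
    then have "x * (real m * (x - y) * x ^ (m - 1)) / x ^ m = real m * (x - y) * x ^ m / x ^ m"
      by (rule arg_cong)
    also have "\<dots> = real m * (x - y)" using x by simp
    finally show ?thesis .
  qed
  finally have "x / x ^ m \<le> real m * (x - y)" .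
  moreover have "real (Suc k) powr (1 / real m - 1) = x / x ^ m"
    unfolding xm using powr_diff[of "real (Suc k)" "1 / real m" 1] by (simp add: x_def del: of_nat_Suc)
  ultimately show ?thesis by (simp add: x_def y_def)
qed

text \<open>For \<open>s \<le> 1\<close> the ratio \<open>k / (k + 1)\<close>, being at most 1, does
  not exceed its \<open>s\<close>-th power.\<close>

lemma powr_diff_le:
  fixes k :: nat
  assumes "0 < s" "s \<le> 1"
  shows "real (Suc k) powr s - real k powr s \<le> real (Suc k) powr (s - 1)"
proof -
  define x where "x = real (Suc k)"
  have x: "x > 0" by (simp add: x_def)
  have "(real k / x) powr 1 \<le> (real k / x) powr s"
    using assms by (intro powr_mono') (auto simp: x_def)
  then have "x powr s * (real k / x) \<le> x powr s * (real k / x) powr s"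
    using x by (intro mult_left_mono) auto
  also have "\<dots> = real k powr s"
    using x by (simp add: powr_divide)
  finally have "x powr s * (real k / x) \<le> real k powr s" .
  moreover have "x powr s - x powr s * (real k / x) = x powr (s - 1)"
    using x by (simp add: powr_diff field_simps) (simp add: x_def algebra_simps)
  ultimately show ?thesis by (simp add: x_def)
qed

text \<open>The exponent is at most 0, so the worst set of given size is an initial segment of the
  positive integers, where \<open>powr_diff_ge\<close> telescopes.\<close>

lemma sum_powr_le_card:
  assumes m: "m \<ge> 1" and "finite I" "0 \<notin> I"
  shows "(\<Sum>k\<in>I. real k powr (1 / real m - 1)) \<le> real m * real (card I) powr (1 / real m)"
  using assms(2,3)
proof (induction I rule: finite_linorder_max_induct)
  case (insert b A)
  have "card A \<le> card {1..<b}"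
    using insert by (intro card_mono) (auto simp: Suc_le_eq intro!: Nat.gr0I)
  then have "Suc (card A) \<le> b" using insert.prems by (cases b) auto
  then have "real b powr (1 / real m - 1) \<le> real (Suc (card A)) powr (1 / real m - 1)"
    using m by (intro powr_mono2') auto
  also have "\<dots> \<le> real m * (real (Suc (card A)) powr (1 / real m) - real (card A) powr (1 / real m))"
    by (rule powr_diff_ge[OF m])
  finally show ?case
    using insert by (auto simp: algebra_simps)
qed auto

text \<open>Both sides are integrals over levels \<open>t\<close>. If \<open>H k > t\<close>, all
  prime factors \<open>p\<close> of \<open>\<nu> k\<close> satisfy \<open>h p > t\<close>, so the
  number of such \<open>k\<close> is at most the \<open>m\<close>-th power of the number of such
  \<open>p\<close>; the power sum over these \<open>k\<close> undoes this power.\<close>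

lemma layer_cake_bound:
  fixes h :: "nat \<Rightarrow> real" and \<nu> :: "nat \<Rightarrow> nat"
  assumes m: "m \<ge> 1" and Q: "finite Q" and h: "\<And>p. h p \<ge> 0"
    and I: "finite I" "0 \<notin> I" and inj: "inj_on \<nu> I"
    and \<nu>: "\<And>k. k \<in> I \<Longrightarrow> \<nu> k > 0 \<and> size (prime_factorization (\<nu> k)) = m \<and> prime_factors (\<nu> k) \<subseteq> Q"
    and H: "\<And>k p. k \<in> I \<Longrightarrow> p \<in> prime_factors (\<nu> k) \<Longrightarrow> H k \<le> h p" and H0: "\<And>k. k \<in> I \<Longrightarrow> H k \<ge> 0"
  shows "(\<Sum>k\<in>I. H k * real k powr (1 / real m - 1)) \<le> real m * (\<Sum>p\<in>Q. h p)"
proof -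
  define w where "w k = real k powr (1 / real m - 1)" for k :: nat
  have w: "w k \<ge> 0" for k by (simp add: w_def)
  have pt: "(\<Sum>k\<in>I. w k * indicator {0..<H k} t) \<le> real m * (\<Sum>p\<in>Q. indicator {0..<h p} t)" for t :: real
  proof (cases "t \<ge> 0")
    case True
    define J where "J = {k \<in> I. t < H k}"
    define S where "S = {p \<in> Q. t < h p}"
    have fin: "finite J" "finite S" and J0: "0 \<notin> J" using I Q by (auto simp: J_def S_def)
    have "card J = card (\<nu> ` J)"
      using inj by (intro card_image [symmetric]) (auto simp: J_def inj_on_def)
    also have "\<dots> \<le> card {n. n > 0 \<and> size (prime_factorization n) = m \<and> prime_factors n \<subseteq> S}"
      using \<nu> H by (intro card_mono smooth_numbers_card fin) (fastforce simp: J_def S_def)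
    also have "\<dots> \<le> card S ^ m" by (intro smooth_numbers_card fin)
    finally have cJ: "real (card J) \<le> real (card S) ^ m" by (metis of_nat_le_iff of_nat_power)
    have "(\<Sum>k\<in>I. w k * indicator {0..<H k} t) = (\<Sum>k\<in>I. if t < H k then w k else 0)"
      using True by (intro sum.cong) (auto simp: indicator_def)
    also have "\<dots> = (\<Sum>k\<in>J. w k)"
      unfolding J_def by (rule sum.inter_filter [symmetric]) (rule I)
    also have "\<dots> \<le> real m * real (card J) powr (1 / real m)"
      unfolding w_def by (rule sum_powr_le_card[OF m fin(1) J0])
    also have "\<dots> \<le> real m * (real (card S) ^ m) powr (1 / real m)"
      using cJ by (intro mult_left_mono powr_mono2) auto
    also have "(real (card S) ^ m) powr (1 / real m) = real (card S)"
      using m by (cases "card S = 0") (auto simp: powr_powr simp flip: powr_realpow)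
    also have "real (card S) = (\<Sum>p\<in>S. 1)" by simp
    also have "\<dots> = (\<Sum>p\<in>Q. if t < h p then 1 else 0)"
      unfolding S_def by (rule sum.inter_filter) (rule Q)
    also have "\<dots> = (\<Sum>p\<in>Q. indicator {0..<h p} t)"
      using True by (intro sum.cong) (auto simp: indicator_def)
    finally show ?thesis .
  qed auto
  have len: "(\<integral>\<^sup>+ t. ennreal (indicator {0..<x} t) \<partial>lborel) = ennreal x" if "x \<ge> 0" for x :: real
    using that by (simp add: ennreal_indicator)
  have "ennreal (\<Sum>k\<in>I. H k * w k) = (\<Sum>k\<in>I. ennreal (w k) * (\<integral>\<^sup>+ t. ennreal (indicator {0..<H k} t) \<partial>lborel))"
    using w H0 by (simp add: len mult.commute flip: sum_ennreal ennreal_mult)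
  also have "\<dots> = (\<integral>\<^sup>+ t. ennreal (\<Sum>k\<in>I. w k * indicator {0..<H k} t) \<partial>lborel)"
    using w by (simp add: ennreal_mult nn_integral_cmult nn_integral_sum flip: sum_ennreal)
  also have "\<dots> \<le> (\<integral>\<^sup>+ t. ennreal (real m * (\<Sum>p\<in>Q. indicator {0..<h p} t)) \<partial>lborel)"
    by (intro nn_integral_mono ennreal_leI pt)
  also have "\<dots> = ennreal (real m) * (\<Sum>p\<in>Q. (\<integral>\<^sup>+ t. ennreal (indicator {0..<h p} t) \<partial>lborel))"
    by (simp add: ennreal_mult sum_nonneg nn_integral_cmult nn_integral_sum flip: sum_ennreal)
  also have "\<dots> = ennreal (real m * (\<Sum>p\<in>Q. h p))"
    using h by (simp add: len sum_nonneg ennreal_mult)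
  finally show ?thesis
    using h by (simp add: w_def sum_nonneg)
qed

text \<open>The enumeration \<open>\<nu>\<close> need not list \<open>|x\<^sub>n|\<close> in decreasing order, so no decreasing rearrangement
  has to be constructed when the criterion is applied.\<close>
lemma lorentz_p1I:
  fixes x :: "nat \<Rightarrow> 'a::real_normed_vector"
  assumes p: "1 \<le> p"
    and C: "\<And>K \<nu>. inj_on \<nu> {1..K::nat} \<Longrightarrow> (\<Sum>k=1..K. norm (x (\<nu> k)) * real k powr (1 / p - 1)) \<le> C"
  shows "x \<in> lorentz_p1 p"
proof -
  \<comment> \<open>For \<open>K = 1\<close> the hypothesis bounds a single term, since
    \<open>1 powr _ = 1\<close>.\<close>
  have bdd: "norm (x n) \<le> C" for n
    using C[of "\<lambda>_. n" 1] by simp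
  define R where "R k = {t::real. t \<ge> 0 \<and> finite {n. norm (x n) > t} \<and> card {n. norm (x n) > t} < k}" for k
  define r where "r k = decr_rearr x k" for k
  have rR: "r k = Inf (R k)" for k by (simp add: r_def R_def decr_rearr_def)
  have "C \<in> R (Suc k)" for k
  proof -
    have "{n. C < norm (x n)} = {}" using bdd by (auto simp: not_less)
    moreover have "C \<ge> 0" using bdd norm_ge_zero order_trans by blast
    ultimately show ?thesis by (simp add: R_def)
  qed
  then have ne: "R (Suc k) \<noteq> {}" for k by blast
  have below: "bdd_below (R k)" for k by (auto simp: R_def bdd_below_def)
  have r0: "r (Suc k) \<ge> 0" for k
    unfolding rR by (intro cInf_greatest ne) (auto simp: R_def)
  \<comment> \<open>Distinct indices are picked one by one. The loss \<open>\<epsilon>\<close> is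
    there because the infimum defining \<open>r k\<close> need not be attained by any
    \<open>norm (x n)\<close>.\<close>
  have greedy: "\<exists>\<nu>. inj_on \<nu> {1..K} \<and> (\<forall>k\<in>{1..K}. norm (x (\<nu> k)) \<ge> r k - \<epsilon>)" if "\<epsilon> > 0" for K \<epsilon>
  proof (induction K)
    case (Suc K)
    then obtain \<nu> where \<nu>: "inj_on \<nu> {1..K}" "\<forall>k\<in>{1..K}. norm (x (\<nu> k)) \<ge> r k - \<epsilon>" by blast
    define t where "t = r (Suc K) - \<epsilon>"
    have "\<exists>n. n \<notin> \<nu> ` {1..K} \<and> norm (x n) \<ge> t"
    proof (cases "t \<ge> 0")
      \<comment> \<open>A level below the infimum is exceeded at more than \<open>K\<close> indices,
        one of which is fresh.\<close>
      case True
      have "t \<notin> R (Suc K)"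
        using cInf_lower[OF _ below, of t "Suc K"] \<open>\<epsilon> > 0\<close> by (auto simp: t_def rR)
      then have *: "infinite {n. norm (x n) > t} \<or> card {n. norm (x n) > t} \<ge> Suc K"
        using True by (auto simp: R_def)
      have "\<not> {n. norm (x n) > t} \<subseteq> \<nu> ` {1..K}"
      proof
        assume sub: "{n. norm (x n) > t} \<subseteq> \<nu> ` {1..K}"
        then have "card {n. norm (x n) > t} \<le> card (\<nu> ` {1..K})" by (intro card_mono) auto
        also have "\<dots> \<le> card {1..K}" by (intro card_image_le) auto
        finally show False using * sub finite_subset by fastforce
      qed
      then show ?thesis using less_imp_le by auto
    next
      case False
      have "\<exists>n. n \<notin> \<nu> ` {1..K}"
        by (meson ex_new_if_finite finite_atLeastAtMost finite_imageI infinite_UNIV_nat)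
      then show ?thesis using False by (meson linear norm_ge_zero order_trans)
    qed
    then obtain n where n: "n \<notin> \<nu> ` {1..K}" "norm (x n) \<ge> t" by blast
    define \<mu> where "\<mu> = \<nu>(Suc K := n)"
    have \<mu>: "\<mu> k = \<nu> k" if "k \<in> {1..K}" for k using that by (simp add: \<mu>_def)
    have \<mu>S: "\<mu> (Suc K) = n" by (simp add: \<mu>_def)
    have split: "{1..Suc K} = insert (Suc K) {1..K}" by auto
    have "inj_on \<mu> {1..K}" using \<nu>(1) \<mu> inj_on_cong by blast
    moreover have "\<mu> ` {1..K} = \<nu> ` {1..K}" using \<mu> by (rule image_cong[OF refl])
    ultimately have "inj_on \<mu> {1..Suc K}"
      unfolding split inj_on_insert using n(1) \<mu>S by fastforce
    moreover have "\<forall>k\<in>{1..Suc K}. norm (x (\<mu> k)) \<ge> r k - \<epsilon>"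
      unfolding split using \<nu>(2) n(2) \<mu> \<mu>S by (auto simp only: t_def insert_iff)
    ultimately show ?case by blast
  qed auto
  define w where "w k = real (Suc k) powr (1/p) - real k powr (1/p)" for k
  have w0: "w k \<ge> 0" for k
    using p by (simp add: w_def powr_mono2)
  have wle: "w k \<le> real (Suc k) powr (1/p - 1)" for k
    unfolding w_def using p by (intro powr_diff_le) auto
  have "summable (\<lambda>k. r (Suc k) * w k)"
  proof (rule summableI_nonneg_bounded)
    show "0 \<le> r (Suc k) * w k" for k using r0 w0 by simp
    fix K
    define W where "W = (\<Sum>k<K. w k)"
    have W: "W \<ge> 0" using w0 by (simp add: W_def sum_nonneg)
    \<comment> \<open>Makes the accumulated loss \<open>\<epsilon> * W\<close> at most 1; the
      \<open>1 +\<close> guards against \<open>W = 0\<close>.\<close>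
    define \<epsilon> where "\<epsilon> = 1 / (1 + W)"
    have \<epsilon>: "\<epsilon> > 0" using W by (simp add: \<epsilon>_def add_pos_nonneg)
    have \<epsilon>W: "\<epsilon> * W \<le> 1" using W by (simp add: \<epsilon>_def divide_simps)
    from greedy[OF \<epsilon>] obtain \<nu> where \<nu>: "inj_on \<nu> {1..K}" "\<forall>k\<in>{1..K}. norm (x (\<nu> k)) \<ge> r k - \<epsilon>" by blast
    have "(\<Sum>k<K. r (Suc k) * w k) - \<epsilon> * W = (\<Sum>k<K. (r (Suc k) - \<epsilon>) * w k)"
      by (simp add: W_def algebra_simps sum_subtractf sum_distrib_left)
    also have "\<dots> \<le> (\<Sum>k<K. norm (x (\<nu> (Suc k))) * real (Suc k) powr (1/p - 1))"
    proof (intro sum_mono)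
      fix k assume "k \<in> {..<K}"
      then have "(r (Suc k) - \<epsilon>) * w k \<le> norm (x (\<nu> (Suc k))) * w k"
        using \<nu>(2) w0 by (intro mult_right_mono) auto
      also have "\<dots> \<le> norm (x (\<nu> (Suc k))) * real (Suc k) powr (1/p - 1)"
        by (intro mult_left_mono wle) auto
      finally show "(r (Suc k) - \<epsilon>) * w k \<le> norm (x (\<nu> (Suc k))) * real (Suc k) powr (1/p - 1)" .
    qed
    also have "\<dots> = (\<Sum>k=1..K. norm (x (\<nu> k)) * real k powr (1/p - 1))"
      by (rule sum.reindex_bij_witness[of _ "\<lambda>k. k - 1" Suc]) auto
    also have "\<dots> \<le> C" by (rule C[OF \<nu>(1)])
    finally show "(\<Sum>k<K. r (Suc k) * w k) \<le> C + 1" using \<epsilon>W by linarith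
  qed
  moreover have "bounded (range x)"
    using bdd by (auto simp: bounded_iff)
  ultimately show ?thesis
    by (simp add: lorentz_p1_def r_def w_def)
qed

section \<open>Bohr lift of a bounded Dirichlet series\<close>

lemma norm_powr_diff_le:
  fixes w :: complex and n :: nat
  assumes w: "Re w > 0"
  shows "norm (of_nat (Suc n) powr (-w) - of_nat (Suc (Suc n)) powr (-w)) \<le> norm w * real (Suc n) powr (- Re w - 1)"
proof -
  let ?S = "closed_segment (of_real (real (Suc n))) (of_real (real (Suc (Suc n)))) :: complex set"
  have S: "\<exists>x. z = of_real x \<and> real (Suc n) \<le> x" if "z \<in> ?S" for z
    using that unfolding closed_segment_of_real by (auto simp: closed_segment_eq_real_ivl simp del: of_nat_Suc)
  have "norm ((of_real (real (Suc n)) :: complex) powr (-w) - of_real (real (Suc (Suc n))) powr (-w))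
      \<le> norm w * real (Suc n) powr (- Re w - 1) * norm (of_real (real (Suc n)) - of_real (real (Suc (Suc n))) :: complex)"
  proof (rule field_differentiable_bound[of ?S "\<lambda>z. z powr (-w)" "\<lambda>z. -w * z powr (-w - 1)"])
    fix z assume "z \<in> ?S"
    then obtain x where x: "z = of_real x" "real (Suc n) \<le> x" using S by blast
    then have x0: "x > 0" by auto
    then have "z \<notin> \<real>\<^sub>\<le>\<^sub>0" using x by simp
    then show "((\<lambda>z. z powr (-w)) has_field_derivative -w * z powr (-w - 1)) (at z within ?S)"
      by (rule has_field_derivative_at_within[OF has_field_derivative_powr])
    have "norm (-w * z powr (-w - 1)) = norm w * x powr (- Re w - 1)"
      using x x0 by (simp add: norm_mult norm_powr_real_powr)
    also have "\<dots> \<le> norm w * real (Suc n) powr (- Re w - 1)"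
      using x w by (intro mult_left_mono powr_mono2') auto
    finally show "norm (-w * z powr (-w - 1)) \<le> norm w * real (Suc n) powr (- Re w - 1)" .
  qed auto
  moreover have "(of_real (real (Suc n)) - of_real (real (Suc (Suc n))) :: complex) = -1"
    by simp
  ultimately show ?thesis by (simp only: of_real_of_nat_eq) simp
qed

text \<open>Supplies the majorant for dominated convergence: uniform in \<open>N\<close> and linear
  in \<open>w\<close>. The partial sums at \<open>s\<close> are bounded by convergence, and the
  factors \<open>n powr (-w)\<close> have total variation at most \<open>norm w * Z\<close>.\<close>

lemma dirichlet_partial_sum_bound:
  fixes a :: "nat \<Rightarrow> complex"
  assumes sm: "summable (\<lambda>n. a n / of_nat n powr s)" and \<delta>: "\<delta> > 0"
  obtains C where "C \<ge> 0"
    "\<And>N w. Re w = \<delta> \<Longrightarrow> norm (\<Sum>n<N. a n / of_nat n powr (s + w)) \<le> C * (1 + norm w)"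
proof -
  define c where "c n = a (Suc n) / of_nat (Suc n) powr s" for n
  define T where "T n = (\<Sum>i<n. c i)" for n
  have "summable c" using sm summable_Suc_iff[of "\<lambda>n. a n / of_nat n powr s"] by (simp add: c_def [abs_def])
  then have "convergent T" by (simp add: T_def [abs_def] summable_iff_convergent)
  then obtain C where C: "C > 0" "\<And>n. norm (T n) \<le> C"
    using convergent_imp_Bseq BseqE by metis
  define Z where "Z = (\<Sum>n. real (Suc n) powr (- \<delta> - 1))"
  have Zs: "summable (\<lambda>n. real (Suc n) powr (- \<delta> - 1))"
    using \<delta> summable_Suc_iff[of "\<lambda>n. real n powr (- \<delta> - 1)"] by (simp add: summable_real_powr_iff)
  have Z0: "Z \<ge> 0" unfolding Z_def by (intro suminf_nonneg Zs) auto
  show ?thesis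
  proof (rule that[of "C * (1 + Z)"])
    show "C * (1 + Z) \<ge> 0" using C Z0 by simp
    fix N and w :: complex assume w: "Re w = \<delta>"
    define g where "g n = (of_nat (Suc n) :: complex) powr (-w)" for n
    have ng: "norm (g n) \<le> 1" for n
      using w \<delta> powr_mono2'[of "-\<delta>" 1 "real (Suc n)"] by (simp add: g_def norm_powr_real_powr)
    \<comment> \<open>Abel summation; the growth in \<open>w\<close> comes only from the total variation of \<open>g\<close>.\<close>
    have parts: "(\<Sum>n<N. c n * g n) = T N * g N + (\<Sum>n<N. T (Suc n) * (g n - g (Suc n)))" for N
      by (induction N) (auto simp: T_def algebra_simps)
    have bound: "norm (\<Sum>n<N. c n * g n) \<le> C * (1 + Z) * (1 + norm w)" for N
    proof -
      have "norm (\<Sum>n<N. T (Suc n) * (g n - g (Suc n))) \<le> (\<Sum>n<N. C * (norm w * real (Suc n) powr (- \<delta> - 1)))"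
        using norm_powr_diff_le[of w] w \<delta> C
        by (intro sum_norm_le) (auto simp: norm_mult g_def simp del: of_nat_Suc intro!: mult_mono)
      also have "\<dots> = C * norm w * (\<Sum>n<N. real (Suc n) powr (- \<delta> - 1))"
        by (simp add: sum_distrib_left mult_ac)
      also have "\<dots> \<le> C * norm w * Z"
        unfolding Z_def using C by (intro mult_left_mono sum_le_suminf Zs) auto
      finally have "norm (\<Sum>n<N. T (Suc n) * (g n - g (Suc n))) \<le> C * norm w * Z" .
      moreover have "norm (T N * g N) \<le> C * 1"
        unfolding norm_mult using C ng by (intro mult_mono) auto
      ultimately have "norm (\<Sum>n<N. c n * g n) \<le> C + C * norm w * Z"
        unfolding parts using norm_triangle_ineq order_trans add_mono by (metis (no_types, lifting) mult.right_neutral)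
      also have "\<dots> \<le> C * (1 + Z) * (1 + norm w)"
        using C Z0 by (simp add: algebra_simps)
      finally show ?thesis .
    qed
    show "norm (\<Sum>n<N. a n / of_nat n powr (s + w)) \<le> C * (1 + Z) * (1 + norm w)"
    proof (cases N)
      case 0
      then show ?thesis using C Z0 by simp
    next
      case (Suc N')
      \<comment> \<open>The term at index 0 vanishes, because \<open>0 powr _ = 0\<close> and
        division by 0 gives 0.\<close>
      have "(\<Sum>n<N. a n / of_nat n powr (s + w)) = (\<Sum>n<N'. a (Suc n) / of_nat (Suc n) powr (s + w))"
        unfolding Suc by (subst sum.lessThan_Suc_shift) simp
      also have "\<dots> = (\<Sum>n<N'. c n * g n)"
        by (intro sum.cong refl) (simp add: c_def g_def powr_add powr_minus divide_inverse del: of_nat_Suc)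
      finally show ?thesis using bound by simp
    qed
  qed
qed

text \<open>A Gaussian in \<open>ln n\<close> decays faster than any power of \<open>n\<close>; the
  power -2 is summable, and completing the square gives the constant.\<close>

lemma gaussian_le_powr:
  assumes "r > 0" "n > 0"
  shows "exp (- (r * ln (real n))\<^sup>2 / 2) \<le> exp (2 / r\<^sup>2) * real n powr -2"
proof -
  define l where "l = ln (real n)"
  have "0 \<le> (r * l - 2 / r)\<^sup>2" by simp
  also have "\<dots> = (r * l)\<^sup>2 - 4 * l + 4 / r\<^sup>2"
    using assms by (simp add: power2_diff power_divide)
  finally have "- (r * l)\<^sup>2 / 2 \<le> 2 / r\<^sup>2 + (-2) * l" by simp
  then have "exp (- (r * l)\<^sup>2 / 2) \<le> exp (2 / r\<^sup>2 + (-2) * l)" by simp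
  also have "\<dots> = exp (2 / r\<^sup>2) * real n powr -2"
    using assms by (simp only: exp_add powr_def l_def) simp
  finally show ?thesis by (simp add: l_def)
qed

text \<open>The series is integrated term by term against a normal density. Conditional convergence suffices,
  since the partial sums grow at most linearly along vertical lines.\<close>
lemma gaussian_smoothing:
  fixes a :: "nat \<Rightarrow> complex"
  assumes sm: "\<And>s. Re s > 0 \<Longrightarrow> summable (\<lambda>n. a n / of_nat n powr s)"
    and B: "\<And>s. Re s > 0 \<Longrightarrow> norm (dirichlet_sum a s) \<le> B"
    and \<sigma>: "\<sigma> > 0" and r: "r > 0"
  defines "b \<equiv> \<lambda>n. a n / of_nat n powr of_real \<sigma> * of_real (exp (- (r * ln (real n))\<^sup>2 / 2))"
  shows "summable (\<lambda>n. norm (b n))"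
    and "norm (\<Sum>n. b n * of_nat n powr (- \<i> * of_real t)) \<le> B"
proof -
  have "summable (\<lambda>n. a n / of_nat n powr of_real \<sigma>)" using sm \<sigma> by simp
  then have "Bseq (\<lambda>n. a n / of_nat n powr of_real \<sigma>)"
    by (intro convergent_imp_Bseq convergentI[OF summable_LIMSEQ_zero])
  then obtain C where C: "\<And>n. norm (a n / of_nat n powr of_real \<sigma>) \<le> C"
    unfolding Bseq_def by blast
  show sb: "summable (\<lambda>n. norm (b n))"
  proof (rule summable_comparison_test)
    show "\<exists>N. \<forall>n\<ge>N. norm (norm (b n)) \<le> C * (exp (2 / r\<^sup>2) * real n powr -2)"
    proof (intro exI[of _ 1] allI impI)
      fix n :: nat assume "n \<ge> 1"
      then have "norm (b n) \<le> C * (exp (2 / r\<^sup>2) * real n powr -2)"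
        unfolding b_def norm_mult using C[of n] gaussian_le_powr[OF r, of n] order_trans[OF norm_ge_zero C[of n]]
        by (intro mult_mono) auto
      then show "norm (norm (b n)) \<le> C * (exp (2 / r\<^sup>2) * real n powr -2)" by simp
    qed
    show "summable (\<lambda>n. C * (exp (2 / r\<^sup>2) * real n powr -2))"
      by (intro summable_mult) (simp add: summable_real_powr_iff)
  qed
  let ?N = std_normal_distribution
  interpret N: real_distribution ?N by (rule real_dist_normal_dist)
  \<comment> \<open>With \<open>x\<close> standard normal, averaging over \<open>s x\<close>
    multiplies the \<open>n\<close>-th term by the characteristic function at
    \<open>- (r * ln n)\<close>, which is the Gaussian weight in \<open>b\<close>.\<close>
  define s where "s x = of_real \<sigma> + \<i> * of_real (t + r * x)" for x :: real
  define F where "F k x = (\<Sum>n<k. a n / of_nat n powr s x)" for k x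
  have term_eq: "a n / of_nat n powr s x
      = a n / of_nat n powr of_real \<sigma> * of_nat n powr (- \<i> * of_real t) * iexp (- (r * ln (real n)) * x)" for n x
  proof (cases "n = 0")
    case False
    have "of_nat n powr s x = of_nat n powr (of_real \<sigma>) * of_nat n powr (\<i> * of_real t) * of_nat n powr (\<i> * of_real (r * x))"
      by (simp add: s_def powr_add [symmetric] algebra_simps)
    moreover have "of_nat n powr (- \<i> * of_real t) = inverse ((of_nat n :: complex) powr (\<i> * of_real t))"
      by (simp add: powr_minus)
    moreover have "iexp (- (r * ln (real n)) * x) = inverse ((of_nat n :: complex) powr (\<i> * of_real (r * x)))"
      using False by (simp add: powr_def exp_minus Ln_of_nat mult_ac)
    ultimately show ?thesis by (simp add: divide_inverse)
  qed simp
  have iexp_int: "integrable ?N (\<lambda>x. iexp (u * x))" for u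
    by (rule N.integrable_const_bound[of _ 1]) auto
  have meas: "F k \<in> borel_measurable ?N" for k
    unfolding F_def term_eq by measurable
  have intF: "integral\<^sup>L ?N (F k) = (\<Sum>n<k. b n * of_nat n powr (- \<i> * of_real t))" for k
  proof -
    have "integral\<^sup>L ?N (F k) = (\<Sum>n<k. a n / of_nat n powr of_real \<sigma> * of_nat n powr (- \<i> * of_real t)
        * (CLINT x|?N. iexp (- (r * ln (real n)) * x)))"
      unfolding F_def term_eq
      by (subst Bochner_Integration.integral_sum, rule integrable_mult_right, rule iexp_int)
        (simp only: integral_mult_right_zero)
    also have "\<dots> = (\<Sum>n<k. b n * of_nat n powr (- \<i> * of_real t))"
    proof (intro sum.cong refl)
      fix n
      have "(CLINT x|?N. iexp (- (r * ln (real n)) * x)) = char ?N (- (r * ln (real n)))"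
        by (simp add: char_def)
      also have "\<dots> = of_real (exp (- (r * ln (real n))\<^sup>2 / 2))"
        by (simp add: char_std_normal_distribution)
      finally show "a n / of_nat n powr of_real \<sigma> * of_nat n powr (- \<i> * of_real t)
        * (CLINT x|?N. iexp (- (r * ln (real n)) * x)) = b n * of_nat n powr (- \<i> * of_real t)"
        by (simp add: b_def mult_ac)
    qed
    finally show ?thesis .
  qed
  have Re_s: "Re (s x) > 0" for x using \<sigma> by (simp add: s_def)
  have limF: "(\<lambda>k. F k x) \<longlonglongrightarrow> dirichlet_sum a (s x)" for x
    unfolding F_def dirichlet_sum_def using summable_LIMSEQ[OF sm[OF Re_s]] .
  \<comment> \<open>Half of \<open>\<sigma>\<close> secures convergence at the base point, the other
    half the positive real part of \<open>w\<close>.\<close>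
  have "summable (\<lambda>n. a n / of_nat n powr of_real (\<sigma> / 2))" using sm \<sigma> by simp
  then obtain C where C: "C \<ge> 0"
    "\<And>k w. Re w = \<sigma> / 2 \<Longrightarrow> norm (\<Sum>n<k. a n / of_nat n powr (of_real (\<sigma> / 2) + w)) \<le> C * (1 + norm w)"
    using dirichlet_partial_sum_bound[of a "of_real (\<sigma> / 2)" "\<sigma> / 2"] \<sigma> by (metis half_gt_zero)
  define G where "G x = C * (1 + (\<sigma> / 2 + \<bar>t\<bar>)) + C * r * \<bar>x\<bar>" for x :: real
  have Fle: "norm (F k x) \<le> G x" for k x
  proof -
    define w where "w = of_real (\<sigma> / 2) + \<i> * of_real (t + r * x)"
    have s: "s x = of_real (\<sigma> / 2) + w" by (simp add: s_def w_def)
    have "norm w \<le> \<sigma> / 2 + \<bar>t + r * x\<bar>"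
      unfolding w_def using \<sigma> norm_triangle_ineq[of "of_real (\<sigma> / 2)" "\<i> * of_real (t + r * x)"]
      by (simp only: norm_mult norm_of_real norm_ii) simp
    also have "\<dots> \<le> \<sigma> / 2 + \<bar>t\<bar> + r * \<bar>x\<bar>"
      using abs_triangle_ineq[of t "r * x"] r by (simp add: abs_mult)
    finally have "C * (1 + norm w) \<le> C * (1 + (\<sigma> / 2 + \<bar>t\<bar> + r * \<bar>x\<bar>))"
      using C(1) by (intro mult_left_mono) auto
    also have "\<dots> = G x" by (simp add: G_def algebra_simps)
    finally show ?thesis
      unfolding F_def s using C(2)[of w k] by (simp add: w_def)
  qed
  have "integrable ?N (\<lambda>x. \<bar>x\<bar>)"
    using integrable_std_normal_moment_abs[of 1] by (simp add: integrable_density)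
  then have Gint: "integrable ?N G" unfolding G_def by auto
  have Dmeas: "(\<lambda>x. dirichlet_sum a (s x)) \<in> borel_measurable ?N"
    by (rule borel_measurable_LIMSEQ_metric[OF meas limF])
  have lim: "(\<lambda>k. integral\<^sup>L ?N (F k)) \<longlonglongrightarrow> (\<integral>x. dirichlet_sum a (s x) \<partial>?N)"
    by (rule integral_dominated_convergence[OF Dmeas meas Gint]) (use limF Fle in auto)
  have "(\<lambda>k. \<Sum>n<k. b n * of_nat n powr (- \<i> * of_real t)) \<longlonglongrightarrow> (\<integral>x. dirichlet_sum a (s x) \<partial>?N)"
    using lim unfolding intF .
  then have "(\<Sum>n. b n * of_nat n powr (- \<i> * of_real t)) = (\<integral>x. dirichlet_sum a (s x) \<partial>?N)"
    by (simp add: sums_def sums_unique [symmetric])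
  moreover have "norm (\<integral>x. dirichlet_sum a (s x) \<partial>?N) \<le> (\<integral>x. B \<partial>?N)"
  proof -
    have "integrable ?N (\<lambda>x. dirichlet_sum a (s x))"
      by (rule N.integrable_const_bound[of _ B]) (use B Re_s Dmeas in auto)
    then have "(\<integral>x. norm (dirichlet_sum a (s x)) \<partial>?N) \<le> (\<integral>x. B \<partial>?N)"
      by (intro integral_mono) (use B Re_s in auto)
    then show ?thesis by (rule order_trans[OF integral_norm_bound])
  qed
  ultimately show "norm (\<Sum>n. b n * of_nat n powr (- \<i> * of_real t)) \<le> B"
    using N.prob_space by simp
qed

section \<open>Kronecker approximation with logarithms of primes\<close>

lemma independent_log_primes:
  assumes P: "\<And>p. p \<in> P \<Longrightarrow> prime (p::nat)"
  shows "module.independent (\<lambda>r. (*) (real_of_int r)) ((\<lambda>p. ln (real p) / (2 * pi)) ` P)"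
proof -
  interpret Modules.module "(\<lambda>r. (*) (real_of_int r))"
    by (simp add: Modules.module.intro distrib_left mult.commute)
  define \<theta> where "\<theta> p = ln (real p) / (2 * pi)" for p :: nat
  have inj: "inj_on \<theta> P"
    using P prime_gt_0_nat by (force simp: inj_on_def \<theta>_def)
  have "False" if dep: "dependent (\<theta> ` P)"
  proof -
    from dep obtain t u where t: "finite t" "t \<subseteq> \<theta> ` P" "(\<Sum>v\<in>t. real_of_int (u v) * v) = 0"
      and nz: "\<exists>v\<in>t. u v \<noteq> 0"
      unfolding dependent_explicit by blast
    obtain T where T: "T \<subseteq> P" "t = \<theta> ` T" using t(2) by (auto simp: subset_image_iff)
    have injT: "inj_on \<theta> T" using inj T inj_on_subset by blast
    have finT: "finite T" using t(1) T injT finite_imageD by blast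
    have prT: "prime p" if "p \<in> T" for p using that T P by blast
    define e where "e p = u (\<theta> p)" for p
    \<comment> \<open>Separating positive and negative exponents turns the integer relation into an
      equality of two natural prime-power products, to which unique factorization applies.\<close>
    define pos neg where "pos p = nat (e p)" and "neg p = nat (- e p)" for p
    have "(\<Sum>p\<in>T. real_of_int (e p) * ln (real p)) / (2 * pi) = 0"
    proof -
      have "(\<Sum>p\<in>T. real_of_int (e p) * \<theta> p) = 0"
        using t(3) unfolding T(2) e_def by (simp only: sum.reindex[OF injT] o_def)
      then show ?thesis by (simp add: \<theta>_def sum_divide_distrib)
    qed
    then have s0: "(\<Sum>p\<in>T. real_of_int (e p) * ln (real p)) = 0" by simp
    have e: "real_of_int (e p) = real (pos p) - real (neg p)" for p
      by (auto simp: pos_def neg_def)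
    have "(\<Sum>p\<in>T. real (pos p) * ln (real p)) = (\<Sum>p\<in>T. real (neg p) * ln (real p))"
      using s0 unfolding e by (simp add: algebra_simps sum_subtractf)
    moreover have ln_prod: "ln (real (\<Prod>p\<in>T. p ^ f p)) = (\<Sum>p\<in>T. real (f p) * ln (real p))" for f
    proof -
      have "ln (real (\<Prod>p\<in>T. p ^ f p)) = (\<Sum>p\<in>T. ln (real p ^ f p))"
        using finT prT prime_gt_0_nat by (simp add: ln_prod)
      also have "\<dots> = (\<Sum>p\<in>T. real (f p) * ln (real p))"
        using prT prime_gt_0_nat by (intro sum.cong refl) (simp add: ln_realpow)
      finally show ?thesis .
    qed
    ultimately have "ln (real (\<Prod>p\<in>T. p ^ pos p)) = ln (real (\<Prod>p\<in>T. p ^ neg p))" by simp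
    moreover have "(\<Prod>p\<in>T. p ^ f p) > 0" for f using prT prime_gt_0_nat by (simp add: prod_pos)
    ultimately have eq: "(\<Prod>p\<in>T. p ^ pos p) = (\<Prod>p\<in>T. p ^ neg p)"
      by (metis ln_inj_iff of_nat_0_less_iff of_nat_eq_iff)
    have "pos p = neg p" if "p \<in> T" for p
      using arg_cong[OF eq, of "multiplicity p"] that finT prT
      by (simp add: multiplicity_prod_prime_powers)
    then have "e p = 0" if "p \<in> T" for p
      using e[of p] that by simp
    then show False using nz T(2) by (auto simp: e_def)
  qed
  then show ?thesis unfolding \<theta>_def by blast
qed

lemma kronecker_primes:
  fixes z :: "nat \<Rightarrow> complex"
  assumes z: "\<And>p. norm (z p) = 1"
  obtains t :: "nat \<Rightarrow> real"
  where "\<And>p. prime p \<Longrightarrow> p < N \<Longrightarrow> (\<lambda>j. of_nat p powr (- \<i> * of_real (t j))) \<longlonglongrightarrow> z p"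
proof -
  define P where "P = {p. prime p \<and> p < N}"
  have "finite P" by (simp add: P_def)
  then obtain \<pi> where \<pi>: "bij_betw \<pi> {..<card P} P"
    using ex_bij_betw_nat_finite lessThan_atLeast0 by metis
  \<comment> \<open>Dividing by \<open>2 * pi\<close> turns the integers of Kronecker's theorem into
    full turns; the sign in \<open>\<alpha>\<close> matches the exponent
    \<open>- \<i> * t\<close>.\<close>
  define \<theta> where "\<theta> i = ln (real (\<pi> i)) / (2 * pi)" for i
  define \<alpha> where "\<alpha> i = - Arg (z (\<pi> i)) / (2 * pi)" for i
  have \<pi>P: "prime (\<pi> i)" if "i < card P" for i
    using \<pi> that by (auto simp: bij_betw_def P_def)
  have "\<theta> ` {..<card P} = (\<lambda>p. ln (real p) / (2 * pi)) ` (\<pi> ` {..<card P})"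
    by (simp add: \<theta>_def image_image)
  then have "\<theta> ` {..<card P} = (\<lambda>p. ln (real p) / (2 * pi)) ` P"
    using \<pi> by (simp add: bij_betw_imp_surj_on)
  then have ind: "module.independent (\<lambda>r. (*) (real_of_int r)) (\<theta> ` {..<card P})"
    using independent_log_primes[of P] by (simp add: P_def)
  have inj: "inj_on \<theta> {..<card P}"
  proof (rule inj_onI)
    fix i j assume ij: "i \<in> {..<card P}" "j \<in> {..<card P}" "\<theta> i = \<theta> j"
    then have "\<pi> i = \<pi> j"
      using \<pi>P[of i] \<pi>P[of j] prime_gt_0_nat by (auto simp: \<theta>_def)
    then show "i = j" using ij \<pi> by (meson bij_betw_imp_inj_on inj_onD)
  qed
  have "\<exists>t h. \<forall>i<card P. \<bar>t * \<theta> i - of_int (h i) - \<alpha> i\<bar> < 1 / real (Suc j)" for j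
    using Kronecker_thm_1[OF ind inj, of "1 / real (Suc j)" \<alpha>] by (metis divide_pos_pos of_nat_0_less_iff zero_less_Suc zero_less_one)
  then obtain t and h :: "nat \<Rightarrow> nat \<Rightarrow> int"
    where th: "\<And>j i. i < card P \<Longrightarrow> \<bar>t j * \<theta> i - of_int (h j i) - \<alpha> i\<bar> < 1 / real (Suc j)"
    by metis
  show ?thesis
  proof (rule that[of t])
    fix p assume p: "prime p" "p < N"
    then obtain i where i: "i < card P" "p = \<pi> i"
      using \<pi> by (auto simp: P_def bij_betw_def)
    have p0: "p > 0" using p prime_gt_0_nat by blast
    define d where "d j = t j * \<theta> i - of_int (h j i) - \<alpha> i" for j
    have "d \<longlonglongrightarrow> 0"
    proof (rule Lim_null_comparison)
      show "\<forall>\<^sub>F j in sequentially. norm (d j) \<le> 1 / real (Suc j)"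
        using th[OF i(1)] by (auto simp: d_def less_imp_le)
      show "(\<lambda>j. 1 / real (Suc j)) \<longlonglongrightarrow> 0" by (rule LIMSEQ_Suc[OF lim_1_over_n])
    qed
    then have "(\<lambda>j. z p * exp (- \<i> * (2 * of_real pi * of_real (d j)))) \<longlonglongrightarrow> z p * exp (- \<i> * (2 * of_real pi * of_real 0))"
      by (intro tendsto_intros)
    moreover have "of_nat p powr (- \<i> * of_real (t j)) = z p * exp (- \<i> * (2 * of_real pi * of_real (d j)))" for j
    proof -
      have zp: "z p = exp (\<i> * of_real (Arg (z p)))"
        using z[of p] Arg_eq[of "z p"] by (metis mult.left_neutral norm_zero of_real_1 zero_neq_one)
      have "2 * pi * d j = t j * ln (real p) - 2 * pi * of_int (h j i) + Arg (z p)"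
        by (simp add: d_def \<theta>_def \<alpha>_def i(2) algebra_simps)
      then have d_eq: "2 * of_real pi * of_real (d j)
          = of_real (t j) * of_real (ln (real p)) - 2 * of_real pi * of_int (h j i) + (of_real (Arg (z p)) :: complex)"
        by (metis (no_types, lifting) of_real_add of_real_diff of_real_mult of_real_numeral of_real_of_int_eq)
      have "z p * exp (- \<i> * (2 * of_real pi * of_real (d j)))
          = exp (- \<i> * of_real (t j) * of_real (ln (real p)) + of_int (h j i) * (2 * of_real pi * \<i>))"
        by (subst zp, subst d_eq) (simp add: exp_add [symmetric] algebra_simps)
      also have "\<dots> = exp (- \<i> * of_real (t j) * of_real (ln (real p)))"
        unfolding exp_add using exp_integer_2pi[of "of_int (h j i)"] by (simp add: mult_ac)
      finally show ?thesis
        using p0 by (simp add: powr_def Ln_of_nat mult_ac)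
    qed
    ultimately show "(\<lambda>j. of_nat p powr (- \<i> * of_real (t j))) \<longlonglongrightarrow> z p" by simp
  qed
qed

section \<open>From vertical lines to the polydisc\<close>

lemma cmon_powr:
  assumes "n > 0"
  shows "cmon (\<lambda>p. of_nat p powr s) n = of_nat n powr s"
proof -
  have "prod_mset (image_mset (\<lambda>p. of_nat p powr s) A) = of_nat (prod_mset A) powr s" if "\<And>p. p \<in># A \<Longrightarrow> p > 0" for A :: "nat multiset"
    using that
  proof (induction A)
    case (add p A)
    then show ?case
      using powr_times_real[of "of_nat p" "of_nat (prod_mset A)" s] by simp
  qed auto
  then have "cmon (\<lambda>p. of_nat p powr s) n = of_nat (prod_mset (prime_factorization n)) powr s"
    unfolding cmon_def by (metis in_prime_factors_imp_prime prime_gt_0_nat)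
  then show ?thesis using assms by (simp add: prod_mset_prime_factorization_nat)
qed

lemma tendsto_cmon:
  assumes "\<And>p. p \<in> prime_factors n \<Longrightarrow> ((\<lambda>j. z j p) \<longlongrightarrow> y p) F"
  shows "((\<lambda>j. cmon (z j) n) \<longlongrightarrow> cmon y n) F"
proof -
  have "((\<lambda>j. prod_mset (image_mset (z j) A)) \<longlongrightarrow> prod_mset (image_mset y A)) F"
    if "\<And>p. p \<in># A \<Longrightarrow> ((\<lambda>j. z j p) \<longlongrightarrow> y p) F" for A
    using that by (induction A) (auto intro: tendsto_mult)
  then show ?thesis using assms unfolding cmon_def by blast
qed

text \<open>Monomials below \<open>N\<close> involve only primes below \<open>N\<close>, so
  Kronecker's theorem approximates \<open>z\<close> there by points
  \<open>p powr (- \<i> * t)\<close>. At these the partial sum differs from the full series by at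
  most the absolute tail.\<close>

lemma bohr_torus_bound:
  fixes b z :: "nat \<Rightarrow> complex"
  assumes sb: "summable (\<lambda>n. norm (b n))" and b0: "b 0 = 0"
    and B: "\<And>t. norm (\<Sum>n. b n * of_nat n powr (- \<i> * of_real t)) \<le> B"
    and z: "\<And>p. norm (z p) = 1"
  shows "norm (\<Sum>n<N. b n * cmon z n) \<le> B + (\<Sum>n. norm (b (n + N)))"
proof -
  obtain t where t: "\<And>p. prime p \<Longrightarrow> p < N \<Longrightarrow> (\<lambda>j. of_nat p powr (- \<i> * of_real (t j))) \<longlonglongrightarrow> z p"
    using kronecker_primes[where z = z and N = N, OF z] by metis
  have "(\<lambda>j. \<Sum>n<N. b n * cmon (\<lambda>p. of_nat p powr (- \<i> * of_real (t j))) n) \<longlonglongrightarrow> (\<Sum>n<N. b n * cmon z n)"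
  proof (intro tendsto_sum tendsto_mult tendsto_const)
    fix n assume n: "n \<in> {..<N}"
    show "(\<lambda>j. cmon (\<lambda>p. of_nat p powr (- \<i> * of_real (t j))) n) \<longlonglongrightarrow> cmon z n"
    proof (rule tendsto_cmon)
      fix p assume p: "p \<in> prime_factors n"
      then have "p \<le> n" by (metis in_prime_factors_iff dvd_imp_le gr0I)
      then show "(\<lambda>j. of_nat p powr (- \<i> * of_real (t j))) \<longlonglongrightarrow> z p"
        using t[of p] p n by auto
    qed
  qed
  moreover have "(\<Sum>n<N. b n * cmon (\<lambda>p. of_nat p powr s) n) = (\<Sum>n<N. b n * of_nat n powr s)" for s
  proof (intro sum.cong refl)
    show "b n * cmon (\<lambda>p. of_nat p powr s) n = b n * of_nat n powr s" for n
      by (cases "n = 0") (auto simp: b0 cmon_powr)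
  qed
  ultimately have lim: "(\<lambda>j. \<Sum>n<N. b n * of_nat n powr (- \<i> * of_real (t j))) \<longlonglongrightarrow> (\<Sum>n<N. b n * cmon z n)"
    by simp
  have le: "norm (\<Sum>n<N. b n * of_nat n powr (- \<i> * of_real u)) \<le> B + (\<Sum>n. norm (b (n + N)))" for u
  proof -
    define g where "g n = b n * of_nat n powr (- \<i> * of_real u)" for n
    have ng: "norm (g n) = norm (b n)" for n
      by (cases "n = 0") (auto simp: g_def b0 norm_mult norm_powr_real_powr)
    then have sg: "summable (\<lambda>n. norm (g n))" using sb by simp
    have "(\<Sum>n<N. g n) = (\<Sum>n. g n) - (\<Sum>n. g (n + N))"
      using suminf_split_initial_segment[OF summable_norm_cancel[OF sg], of N] by simp
    then have "norm (\<Sum>n<N. g n) \<le> norm (\<Sum>n. g n) + norm (\<Sum>n. g (n + N))"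
      by (simp add: norm_triangle_ineq4)
    also have "norm (\<Sum>n. g (n + N)) \<le> (\<Sum>n. norm (g (n + N)))"
      using sg by (intro summable_norm) (subst summable_iff_shift)
    finally have "norm (\<Sum>n<N. g n) \<le> norm (\<Sum>n. g n) + (\<Sum>n. norm (b (n + N)))"
      by (simp only: ng)
    then show ?thesis using B[of u] unfolding g_def by linarith
  qed
  show ?thesis
    using tendsto_norm[OF lim] by (rule LIMSEQ_le_const2) (use le in blast)
qed

text \<open>The parameter \<open>\<epsilon>\<close> serves as both abscissa and Gaussian width.
  First \<open>N\<close> tends to infinity to remove the tail, then \<open>\<epsilon>\<close> tends
  to 0 to remove the weights.\<close>

lemma bohr_polydisc_bound:
  fixes a z :: "nat \<Rightarrow> complex"
  assumes hom: "m_homogeneous m a"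
    and sm: "\<And>s. Re s > 0 \<Longrightarrow> summable (\<lambda>n. a n / of_nat n powr s)"
    and B: "\<And>s. Re s > 0 \<Longrightarrow> norm (dirichlet_sum a s) \<le> B"
    and Q: "finite Q" and z: "\<And>p. norm (z p) \<le> 1"
  defines "L \<equiv> {n. n > 0 \<and> size (prime_factorization n) = m \<and> prime_factors n \<subseteq> Q}"
  shows "norm (\<Sum>n\<in>L. a n * cmon z n) \<le> B"
proof -
  have finL: "finite L" unfolding L_def by (rule smooth_numbers_card[OF Q])
  \<comment> \<open>Zeros off \<open>Q\<close> kill every monomial with a prime factor outside
    \<open>Q\<close>, so the initial segment of the series reduces to \<open>L\<close>.\<close>
  define y where "y p = (if p \<in> Q then z p else 0)" for p
  have y: "norm (y p) \<le> 1" for p using z by (simp add: y_def)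
  define \<gamma> where "\<gamma> \<epsilon> n = 1 / of_nat n powr of_real \<epsilon> * (of_real (exp (- (\<epsilon> * ln (real n))\<^sup>2 / 2)) :: complex)" for \<epsilon> n
  have bound: "norm (\<Sum>n\<in>L. a n * \<gamma> \<epsilon> n * cmon z n) \<le> B" if \<epsilon>: "\<epsilon> > 0" for \<epsilon>
  proof -
    define b where "b n = a n / of_nat n powr of_real \<epsilon> * of_real (exp (- (\<epsilon> * ln (real n))\<^sup>2 / 2))" for n
    have sb: "summable (\<lambda>n. norm (b n))"
      and Bb: "\<And>t. norm (\<Sum>n. b n * of_nat n powr (- \<i> * of_real t)) \<le> B"
      using gaussian_smoothing[of a B \<epsilon> \<epsilon>] sm B \<epsilon> by (auto simp: b_def)
    have b0: "b 0 = 0" by (simp add: b_def)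
    have "norm (\<Sum>n\<in>L. b n * cmon z n) \<le> B + (\<Sum>n. norm (b (n + N)))" if N: "N > Max (insert 0 L)" for N
    proof -
      have LN: "L \<subseteq> {..<N}"
        using N finL by (auto dest: Max_ge[of "insert 0 L", rotated])
      have "(\<Sum>n\<in>L. b n * cmon z n) = (\<Sum>n\<in>L. b n * cmon y n)"
        by (intro sum.cong refl arg_cong2[of _ _ _ _ "(*)"] cmon_cong) (auto simp: y_def L_def)
      also have "\<dots> = (\<Sum>n<N. b n * cmon y n)"
      proof (rule sum.mono_neutral_left[OF _ LN])
        show "\<forall>n\<in>{..<N} - L. b n * cmon y n = 0"
        proof
          fix n assume n: "n \<in> {..<N} - L"
          show "b n * cmon y n = 0"
          proof (cases "a n = 0")
            case False
            then obtain p where "p \<in> prime_factors n" "p \<notin> Q"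
              using hom n by (auto simp: L_def m_homogeneous_def)
            then have "0 \<in># image_mset y (prime_factorization n)"
              by (force simp: y_def)
            then have "cmon y n = 0"
              unfolding cmon_def by (simp add: prod_mset_zero_iff)
            then show ?thesis by simp
          qed (simp add: b_def)
        qed
      qed auto
      also have "norm \<dots> \<le> B + (\<Sum>n. norm (b (n + N)))"
        by (rule polydisc_bound[OF _ _ y]) (auto intro: bohr_torus_bound[OF sb b0 Bb])
      finally show ?thesis .
    qed
    moreover have "(\<lambda>N. B + (\<Sum>n. norm (b (n + N)))) \<longlonglongrightarrow> B + 0"
      using suminf_exist_split2[OF sb] by (intro tendsto_add tendsto_const)
    ultimately have "norm (\<Sum>n\<in>L. b n * cmon z n) \<le> B + 0"
      by (intro LIMSEQ_le_const) (auto intro!: exI[of _ "Suc (Max (insert 0 L))"])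
    then show ?thesis by (simp add: b_def \<gamma>_def mult_ac)
  qed
  have "(\<lambda>j. \<Sum>n\<in>L. a n * \<gamma> (1 / real (Suc j)) n * cmon z n) \<longlonglongrightarrow> (\<Sum>n\<in>L. a n * \<gamma> 0 n * cmon z n)"
  proof (intro tendsto_sum tendsto_mult tendsto_const)
    fix n assume "n \<in> L"
    then have n: "n > 0" by (simp add: L_def)
    have e: "(\<lambda>j. 1 / real (Suc j)) \<longlonglongrightarrow> 0" by (rule LIMSEQ_Suc[OF lim_1_over_n])
    have "(\<lambda>j. exp (- (of_real (1 / real (Suc j)) * of_real (ln (real n)))) * of_real (exp (- (1 / real (Suc j) * ln (real n))\<^sup>2 / 2)) :: complex)
      \<longlonglongrightarrow> exp (- (of_real 0 * of_real (ln (real n)))) * of_real (exp (- (0 * ln (real n))\<^sup>2 / 2))"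
      by (intro tendsto_intros e) auto
    moreover have "\<gamma> \<epsilon> n = exp (- (of_real \<epsilon> * of_real (ln (real n)))) * of_real (exp (- (\<epsilon> * ln (real n))\<^sup>2 / 2))" for \<epsilon>
    proof -
      have p: "of_nat n powr (of_real \<epsilon> :: complex) = exp (of_real \<epsilon> * of_real (ln (real n)))"
        using n by (simp add: powr_def Ln_of_nat)
      have e: "1 / exp u = exp (- u)" for u :: complex
        by (simp add: exp_minus divide_inverse)
      show ?thesis by (simp only: \<gamma>_def p e)
    qed
    ultimately show "(\<lambda>j. \<gamma> (1 / real (Suc j)) n) \<longlonglongrightarrow> \<gamma> 0 n" by simp
  qed
  also have "(\<Sum>n\<in>L. a n * \<gamma> 0 n * cmon z n) = (\<Sum>n\<in>L. a n * cmon z n)"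
  proof (intro sum.cong refl)
    fix n assume "n \<in> L"
    then have "n \<noteq> 0" by (simp add: L_def)
    then have "\<gamma> 0 n = 1" by (simp add: \<gamma>_def)
    then show "a n * \<gamma> 0 n * cmon z n = a n * cmon z n" by simp
  qed
  finally have lim: "(\<lambda>j. \<Sum>n\<in>L. a n * \<gamma> (1 / real (Suc j)) n * cmon z n) \<longlonglongrightarrow> (\<Sum>n\<in>L. a n * cmon z n)" .
  show ?thesis
    using tendsto_norm[OF lim] by (rule LIMSEQ_le_const2) (auto intro!: exI[of _ 0] bound)
qed

section \<open>Lorentz summability of the coefficients\<close>

text \<open>Only primes dividing the chosen \<open>\<nu> k\<close> enter, so all sums are finite,
  while the bound depends on neither \<open>K\<close> nor \<open>\<nu>\<close>, as
  \<open>lorentz_p1I\<close> demands.\<close>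

lemma homogeneous_weighted_sum_bound:
  fixes a :: "nat \<Rightarrow> complex" and \<nu> :: "nat \<Rightarrow> nat"
  assumes m: "m \<ge> 1" and hom: "m_homogeneous m a"
    and disc: "\<And>Q z. finite Q \<Longrightarrow> (\<And>p. norm (z p) \<le> 1) \<Longrightarrow>
      norm (\<Sum>n | n > 0 \<and> size (prime_factorization n) = m \<and> prime_factors n \<subseteq> Q. a n * cmon z n) \<le> B"
    and inj: "inj_on \<nu> {1..K}"
  shows "(\<Sum>k=1..K. norm (a (\<nu> k)) * real k powr ((1 / real m - 1) / 2)) \<le> (1 + real m) * (2 * 4 ^ m * B)"
proof -
  \<comment> \<open>Nonzero coefficients force \<open>\<nu> k\<close> to have \<open>m\<close> prime
    factors and make \<open>H k\<close> positive, which permits division by it.\<close>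
  define I where "I = {k \<in> {1..K}. a (\<nu> k) \<noteq> 0}"
  define Q where "Q = (\<Union>k\<in>I. prime_factors (\<nu> k))"
  define L where "L = {n. n > 0 \<and> size (prime_factorization n) = m \<and> prime_factors n \<subseteq> Q}"
  define h where "h p = sqrt (\<Sum>n | n \<in> L \<and> p \<in> prime_factors n. (norm (a n))\<^sup>2)" for p
  define H where "H k = Min (h ` prime_factors (\<nu> k))" for k
  have finI: "finite I" and I0: "0 \<notin> I" and I_sub: "I \<subseteq> {1..K}" by (auto simp: I_def)
  have finQ: "finite Q" using finI by (simp add: Q_def)
  have finL: "finite L" unfolding L_def by (rule smooth_numbers_card[OF finQ])
  have injI: "inj_on \<nu> I" using inj I_sub inj_on_subset by blast
  have hom': "\<nu> k > 0 \<and> size (prime_factorization (\<nu> k)) = m \<and> prime_factors (\<nu> k) \<subseteq> Q" if "k \<in> I" for k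
    using that hom by (auto simp: I_def Q_def m_homogeneous_def)
  then have \<nu>L: "\<nu> k \<in> L" if "k \<in> I" for k using that by (simp add: L_def)
  have h0: "h p \<ge> 0" for p by (simp add: h_def sum_nonneg)
  have h2: "(h p)\<^sup>2 = (\<Sum>n | n \<in> L \<and> p \<in> prime_factors n. (norm (a n))\<^sup>2)" for p
    by (simp add: h_def sum_nonneg)
  have hsum: "(\<Sum>p\<in>Q. h p) \<le> 4 * 4 ^ m * B"
    unfolding h_def using disc[OF finQ]
    by (intro mixed_norm_bound[OF finL _ _ finQ]) (auto simp: L_def)
  have ne: "prime_factors (\<nu> k) \<noteq> {}" if "k \<in> I" for k
    using hom'[OF that] m by auto
  have H_att: "\<exists>p \<in> prime_factors (\<nu> k). H k = h p" if "k \<in> I" for k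
  proof -
    have "H k \<in> h ` prime_factors (\<nu> k)"
      unfolding H_def using ne[OF that] by (intro Min_in) auto
    then show ?thesis by blast
  qed
  have h_pos: "h p > 0" if "k \<in> I" "p \<in> prime_factors (\<nu> k)" for k p
  proof -
    have "0 < (norm (a (\<nu> k)))\<^sup>2" using that by (simp add: I_def)
    also have "\<dots> \<le> (h p)\<^sup>2"
      unfolding h2 using \<nu>L that finL by (intro member_le_sum) auto
    finally show ?thesis using h0[of p] by (simp add: order_less_le)
  qed
  \<comment> \<open>The minimum \<open>H k\<close> is some \<open>h p\<close>, so its reciprocal is
    at most the sum of all \<open>1 / h p\<close> over \<open>p\<close> dividing
    \<open>\<nu> k\<close>. After exchanging sums each prime contributes
    \<open>(h p)\<^sup>2 / h p = h p\<close>, also when \<open>h p = 0\<close>.\<close>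
  have part1: "(\<Sum>k\<in>I. (norm (a (\<nu> k)))\<^sup>2 / H k) \<le> (\<Sum>p\<in>Q. h p)"
  proof -
    have "(\<Sum>k\<in>I. (norm (a (\<nu> k)))\<^sup>2 / H k)
        \<le> (\<Sum>k\<in>I. \<Sum>p | p \<in> Q \<and> p \<in> prime_factors (\<nu> k). (norm (a (\<nu> k)))\<^sup>2 / h p)"
    proof (intro sum_mono)
      fix k assume k: "k \<in> I"
      then obtain p where p: "p \<in> prime_factors (\<nu> k)" "H k = h p" using H_att by blast
      then show "(norm (a (\<nu> k)))\<^sup>2 / H k \<le> (\<Sum>p | p \<in> Q \<and> p \<in> prime_factors (\<nu> k). (norm (a (\<nu> k)))\<^sup>2 / h p)"
        unfolding p(2) using finQ h0 hom'[OF k]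
        by (intro member_le_sum[of p _ "\<lambda>p. (norm (a (\<nu> k)))\<^sup>2 / h p"]) auto
    qed
    also have "\<dots> = (\<Sum>n\<in>\<nu> ` I. \<Sum>p | p \<in> Q \<and> p \<in> prime_factors n. (norm (a n))\<^sup>2 / h p)"
      by (simp add: sum.reindex[OF injI])
    also have "\<dots> \<le> (\<Sum>n\<in>L. \<Sum>p | p \<in> Q \<and> p \<in> prime_factors n. (norm (a n))\<^sup>2 / h p)"
      using \<nu>L finL h0 by (intro sum_mono2) (auto intro!: sum_nonneg)
    also have "\<dots> = (\<Sum>p\<in>Q. \<Sum>n | n \<in> L \<and> p \<in> prime_factors n. (norm (a n))\<^sup>2 / h p)"
      by (rule sum.swap_restrict[OF finL finQ])
    also have "\<dots> = (\<Sum>p\<in>Q. h p)"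
    proof (intro sum.cong refl)
      fix p
      have "(\<Sum>n | n \<in> L \<and> p \<in> prime_factors n. (norm (a n))\<^sup>2 / h p) = (h p)\<^sup>2 / h p"
        by (simp add: h2 sum_divide_distrib)
      then show "(\<Sum>n | n \<in> L \<and> p \<in> prime_factors n. (norm (a n))\<^sup>2 / h p) = h p"
        by (simp add: power2_eq_square)
    qed
    finally show ?thesis .
  qed
  have part2: "(\<Sum>k\<in>I. H k * real k powr (1 / real m - 1)) \<le> real m * (\<Sum>p\<in>Q. h p)"
  proof (rule layer_cake_bound[OF m finQ h0 finI I0 injI hom'])
    show "H k \<le> h p" if "k \<in> I" "p \<in> prime_factors (\<nu> k)" for k p
      using that by (auto simp: H_def)
    show "H k \<ge> 0" if "k \<in> I" for k
      using H_att[OF that] h0 by auto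
  qed
  have "(\<Sum>k=1..K. norm (a (\<nu> k)) * real k powr ((1 / real m - 1) / 2))
      = (\<Sum>k\<in>I. norm (a (\<nu> k)) * real k powr ((1 / real m - 1) / 2))"
    using I_sub by (intro sum.mono_neutral_right) (auto simp: I_def)
  also have "\<dots> \<le> (\<Sum>k\<in>I. ((norm (a (\<nu> k)))\<^sup>2 / H k + H k * real k powr (1 / real m - 1)) / 2)"
  proof (intro sum_mono)
    fix k assume k: "k \<in> I"
    define x where "x = norm (a (\<nu> k))"
    define y where "y = real k powr ((1 / real m - 1) / 2)"
    have y2: "real k powr (1 / real m - 1) = y\<^sup>2"
      using powr_add[of "real k" "(1 / real m - 1) / 2" "(1 / real m - 1) / 2"] by (simp add: y_def power2_eq_square)
    have Hp: "H k > 0" using H_att[OF k] h_pos[OF k] by auto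
    \<comment> \<open>Weighted arithmetic-geometric mean inequality; it is the source of the halved
      exponent.\<close>
    have "0 \<le> (x - H k * y)\<^sup>2 / H k" using Hp by simp
    also have "\<dots> = x\<^sup>2 / H k - 2 * (x * y) + H k * y\<^sup>2"
      using Hp by (simp add: power2_eq_square field_simps)
    finally show "norm (a (\<nu> k)) * real k powr ((1 / real m - 1) / 2)
        \<le> ((norm (a (\<nu> k)))\<^sup>2 / H k + H k * real k powr (1 / real m - 1)) / 2"
      unfolding y2 by (simp add: x_def y_def)
  qed
  also have "\<dots> = ((\<Sum>k\<in>I. (norm (a (\<nu> k)))\<^sup>2 / H k) + (\<Sum>k\<in>I. H k * real k powr (1 / real m - 1))) / 2"
    by (simp add: sum.distrib flip: sum_divide_distrib)
  also have "\<dots> \<le> ((\<Sum>p\<in>Q. h p) + real m * (\<Sum>p\<in>Q. h p)) / 2"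
    using part1 part2 by simp
  also have "\<dots> = (1 + real m) * ((\<Sum>p\<in>Q. h p) / 2)" by (simp add: algebra_simps)
  also have "\<dots> \<le> (1 + real m) * (2 * 4 ^ m * B)"
    using hsum by (intro mult_left_mono) auto
  finally show ?thesis .
qed

theorem theorem5p7:
  fixes m :: nat and a :: "nat \<Rightarrow> complex"
  assumes "m \<ge> 1"
    and "a \<in> H_m_infty m"
  shows "a \<in> lorentz_p1 (2 * real m / (real m + 1))"
proof -
  have "m_homogeneous m a \<and> (\<forall>s. Re s > 0 \<longrightarrow> summable (\<lambda>n. a n / of_nat n powr s))
      \<and> (\<exists>B. \<forall>s. Re s > 0 \<longrightarrow> norm (dirichlet_sum a s) \<le> B)"
    using assms(2) unfolding H_m_infty_def mem_Collect_eq .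
  then obtain B where hom: "m_homogeneous m a"
    and sm: "\<And>s. Re s > 0 \<Longrightarrow> summable (\<lambda>n. a n / of_nat n powr s)"
    and B: "\<And>s. Re s > 0 \<Longrightarrow> norm (dirichlet_sum a s) \<le> B"
    by blast
  show ?thesis
  proof (rule lorentz_p1I)
    show "1 \<le> 2 * real m / (real m + 1)"
      using assms(1) by (simp add: field_simps)
    \<comment> \<open>The index \<open>2 * m / (m + 1)\<close> is the one whose weight exponent is
      half the exponent \<open>1 / m - 1\<close> of the layer-cake estimate.\<close>
    have exponent: "1 / (2 * real m / (real m + 1)) - 1 = (1 / real m - 1) / 2"
      using assms(1) by (simp add: field_simps)
    fix K :: nat and \<nu> :: "nat \<Rightarrow> nat" assume inj: "inj_on \<nu> {1..K}"
    show "(\<Sum>k=1..K. norm (a (\<nu> k)) * real k powr (1 / (2 * real m / (real m + 1)) - 1))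
        \<le> (1 + real m) * (2 * 4 ^ m * B)"
      unfolding exponent
      by (rule homogeneous_weighted_sum_bound[OF assms(1) hom bohr_polydisc_bound[OF hom sm B] inj])
  qed
qed

end
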